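(* Consider online Nash welfare maximization with $N$ agents and divisible items arriving online, and let $\mu^*$ denote the impartiality ratio of the instance (not known to the algorithm). The following randomized online algorithm is $O\big(\log^2\mu^*\,(\log\log\mu^* )^2\big)$-competitive: before any item arrives, sample a non-negative integer $k$ with probability $\frac{6}{\pi^2}\cdot\frac{1}{(k+1)^2}$, set $\mu=2^{2^k}$, and then run Greedy with Rounded Values with parameter $\mu$ to allocate all items.
   Context: There are $N$ agents and $T$ divisible items arriving online in the order $t=1,\dots,T$. Item $t$ has supply $s_t>0$ and agent $i$ has value $v_{it}\ge 0$ per unit of item $t$. An allocation is a non-negative vector $(x_{it})$ with $\sum_{i} x_{it}\le s_t$ for every $t$; agent $i$'s utility is $u_i=\sum_t x_{it}v_{it}$, and the Nash welfare is $(\prod_{i=1}^N u_i)^{1/N}$. When an item arrives, an online algorithm observes its supply and the agents' values for it and must irrevocably decide how to allocate it. An algorithm is $\Gamma$-competitive if on every instance, the optimal (offline) Nash welfare is at most $\Gamma$ times the expected Nash welfare of the algorithm's allocation. An allocation with utilities $(u_i)$ is $\mu$-impartial if $u_i\le \mu u_j$ for all agents $i,j$; an instance is $\mu$-impartial if every Nash welfare maximizing allocation is $\mu$-impartial; $\mu^*$ is the smallest such $\mu$. Myopic Greedy: for each arriving item $t$, choose $(x_{it})_i$ maximizing $\sum_{i=1}^N\log\big(\sum_{t'<t}v_{it'}x_{it'}+v_{it}x_{it}\big)$ subject to $\sum_i x_{it}\le s_t$, $x_{it}\ge0$. Greedy with Rounded Values with parameter $\mu$: let $L=\lceil\log_2\mu\rceil$.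 For each arriving item $t$, let $\bar v_t=\max_i v_{it}$, and create sub-items $(t,1),\dots,(t,L)$, each with supply $s_t/L$, where agent $i$'s value for sub-item $(t,j)$ is $\bar v_t/2^j$ if $v_{it}\ge \bar v_t/2^j$ and $0$ otherwise. The sub-items are fed, in the order $(1,1),\dots,(1,L),(2,1),\dots$, to Myopic Greedy, which allocates $x_{i(t,j)}$ of sub-item $(t,j)$ to agent $i$; then agent $i$ receives $x_{it}=\sum_{j=1}^L x_{i(t,j)}$ of item $t$.
   Formalization: In Myopic Greedy, log 0 is read as minus infinity and agents with zero utility so far and zero value for the arriving item are left out of the sum (otherwise all choices tie); the O-bound is read as monotone in the impartiality ratio, so it is a positive constant for small values. *)

theory Defs
  imports "HOL-Probability.Probability" "HOL-Library.Landau_Symbols"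
begin

(* Agents are 0..<N and items 0..<T, arriving in increasing order; s t is the supply of item t,
   v i t the value of agent i per unit of item t, and x i t the amount of item t that agent i
   receives. Values of s, v, x outside these ranges are never consulted. *)

definition valid_instance :: "nat \<Rightarrow> nat \<Rightarrow> (nat \<Rightarrow> real) \<Rightarrow> (nat \<Rightarrow> nat \<Rightarrow> real) \<Rightarrow> bool" where
  "valid_instance N T s v \<longleftrightarrow> N \<ge> 1 \<and> (\<forall>t<T. s t > 0) \<and> (\<forall>i<N. \<forall>t<T. v i t \<ge> 0)"

definition item_allocation :: "nat \<Rightarrow> real \<Rightarrow> (nat \<Rightarrow> real) \<Rightarrow> bool" where
  "item_allocation N \<sigma> y \<longleftrightarrow> (\<forall>i<N. y i \<ge> 0) \<and> (\<Sum>i<N. y i) \<le> \<sigma>"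

definition allocation :: "nat \<Rightarrow> nat \<Rightarrow> (nat \<Rightarrow> real) \<Rightarrow> (nat \<Rightarrow> nat \<Rightarrow> real) \<Rightarrow> bool" where
  "allocation N T s x \<longleftrightarrow> (\<forall>t<T. item_allocation N (s t) (\<lambda>i. x i t))"

definition utility :: "nat \<Rightarrow> (nat \<Rightarrow> nat \<Rightarrow> real) \<Rightarrow> (nat \<Rightarrow> nat \<Rightarrow> real) \<Rightarrow> nat \<Rightarrow> real" where
  "utility T v x i = (\<Sum>t<T. v i t * x i t)"

definition nash_welfare :: "nat \<Rightarrow> nat \<Rightarrow> (nat \<Rightarrow> nat \<Rightarrow> real) \<Rightarrow> (nat \<Rightarrow> nat \<Rightarrow> real) \<Rightarrow> real" where
  "nash_welfare N T v x = root N (\<Prod>i<N. utility T v x i)"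

definition opt_nash_welfare :: "nat \<Rightarrow> nat \<Rightarrow> (nat \<Rightarrow> real) \<Rightarrow> (nat \<Rightarrow> nat \<Rightarrow> real) \<Rightarrow> real" where
  "opt_nash_welfare N T s v = (SUP x\<in>{x. allocation N T s x}. nash_welfare N T v x)"

definition nash_optimal :: "nat \<Rightarrow> nat \<Rightarrow> (nat \<Rightarrow> real) \<Rightarrow> (nat \<Rightarrow> nat \<Rightarrow> real) \<Rightarrow> (nat \<Rightarrow> nat \<Rightarrow> real) \<Rightarrow> bool" where
  "nash_optimal N T s v x \<longleftrightarrow> allocation N T s x \<and>
     (\<forall>y. allocation N T s y \<longrightarrow> nash_welfare N T v y \<le> nash_welfare N T v x)"

definition impartial_allocation :: "nat \<Rightarrow> nat \<Rightarrow> (nat \<Rightarrow> nat \<Rightarrow> real) \<Rightarrow> real \<Rightarrow> (nat \<Rightarrow> nat \<Rightarrow> real) \<Rightarrow> bool" where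
  "impartial_allocation N T v \<mu> x \<longleftrightarrow> (\<forall>i<N. \<forall>j<N. utility T v x i \<le> \<mu> * utility T v x j)"

definition impartial_instance :: "nat \<Rightarrow> nat \<Rightarrow> (nat \<Rightarrow> real) \<Rightarrow> (nat \<Rightarrow> nat \<Rightarrow> real) \<Rightarrow> real \<Rightarrow> bool" where
  "impartial_instance N T s v \<mu> \<longleftrightarrow> (\<forall>x. nash_optimal N T s v x \<longrightarrow> impartial_allocation N T v \<mu> x)"

(* The least element exists whenever the optimal Nash welfare is positive; if the optimal Nash
   welfare is 0 it may fail to exist, and then the value of this definition is unspecified. *)
definition impartiality_ratio :: "nat \<Rightarrow> nat \<Rightarrow> (nat \<Rightarrow> real) \<Rightarrow> (nat \<Rightarrow> nat \<Rightarrow> real) \<Rightarrow> real" where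
  "impartiality_ratio N T s v = (LEAST \<mu>. impartial_instance N T s v \<mu>)"

(* Logarithm with log 0 = -\<infinity> (the library's ln 0 = 0 would be wrong in the greedy objective). *)
definition ext_ln :: "real \<Rightarrow> ereal" where
  "ext_ln a = (if a \<le> 0 then -\<infinity> else ereal (ln a))"

(* u i is the utility agent i has accumulated so far and w i her value for the arriving item.
   An agent with u i = w i = 0 contributes the constant -\<infinity> whatever is done with the
   item, so her term is left out of the sum; if it were kept, every choice, even discarding the
   item, would attain the maximum -\<infinity>. All remaining terms can be made finite at once. *)
definition greedy_objective :: "nat \<Rightarrow> (nat \<Rightarrow> real) \<Rightarrow> (nat \<Rightarrow> real) \<Rightarrow> (nat \<Rightarrow> real) \<Rightarrow> ereal" where
  "greedy_objective N u w y = (\<Sum>i\<in>{i. i < N \<and> (u i > 0 \<or> w i > 0)}. ext_ln (u i + w i * y i))"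

definition greedy_choice :: "nat \<Rightarrow> (nat \<Rightarrow> real) \<Rightarrow> (nat \<Rightarrow> real) \<Rightarrow> real \<Rightarrow> (nat \<Rightarrow> real) \<Rightarrow> bool" where
  "greedy_choice N u w \<sigma> y \<longleftrightarrow> item_allocation N \<sigma> y \<and>
     (\<forall>z. item_allocation N \<sigma> z \<longrightarrow> greedy_objective N u w z \<le> greedy_objective N u w y)"

(* x is a possible outcome of Myopic Greedy; ties are broken arbitrarily. *)
definition myopic_greedy :: "nat \<Rightarrow> nat \<Rightarrow> (nat \<Rightarrow> real) \<Rightarrow> (nat \<Rightarrow> nat \<Rightarrow> real) \<Rightarrow> (nat \<Rightarrow> nat \<Rightarrow> real) \<Rightarrow> bool" where
  "myopic_greedy N T s v x \<longleftrightarrow>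
     (\<forall>t<T. greedy_choice N (utility t v x) (\<lambda>i. v i t) (s t) (\<lambda>i. x i t))"

definition num_levels :: "real \<Rightarrow> nat" where
  "num_levels \<mu> = nat \<lceil>log 2 \<mu>\<rceil>"

definition max_value :: "nat \<Rightarrow> (nat \<Rightarrow> nat \<Rightarrow> real) \<Rightarrow> nat \<Rightarrow> real" where
  "max_value N v t = Max ((\<lambda>i. v i t) ` {..<N})"

(* Sub-item (t, j) with 1 \<le> j \<le> L has index t * L + (j - 1), so index r stands for
   (r div L, r mod L + 1) and increasing r is the prescribed feeding order. *)
definition sub_supply :: "nat \<Rightarrow> (nat \<Rightarrow> real) \<Rightarrow> nat \<Rightarrow> real" where
  "sub_supply L s r = s (r div L) / real L"

definition sub_value :: "nat \<Rightarrow> nat \<Rightarrow> (nat \<Rightarrow> nat \<Rightarrow> real) \<Rightarrow> nat \<Rightarrow> nat \<Rightarrow> real" where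
  "sub_value N L v i r =
     (let t = r div L; a = max_value N v t / 2 ^ (r mod L + 1) in if v i t \<ge> a then a else 0)"

definition greedy_rounded :: "nat \<Rightarrow> nat \<Rightarrow> (nat \<Rightarrow> real) \<Rightarrow> (nat \<Rightarrow> nat \<Rightarrow> real) \<Rightarrow> real \<Rightarrow> (nat \<Rightarrow> nat \<Rightarrow> real) \<Rightarrow> bool" where
  "greedy_rounded N T s v \<mu> x \<longleftrightarrow>
     (let L = num_levels \<mu> in
       \<exists>y. myopic_greedy N (T * L) (sub_supply L s) (sub_value N L v) y \<and>
           (\<forall>i<N. \<forall>t<T. x i t = (\<Sum>j=1..L. y i (t * L + (j - 1)))))"

definition guess_pmf :: "nat pmf" where
  "guess_pmf = embed_pmf (\<lambda>k. 6 / pi\<^sup>2 * (1 / (real k + 1)\<^sup>2))"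

lemma pmf_guess_pmf: "pmf guess_pmf k = 6 / pi\<^sup>2 * (1 / (real k + 1)\<^sup>2)"
  unfolding guess_pmf_def
proof (rule pmf_embed_pmf)
  show "0 \<le> 6 / pi\<^sup>2 * (1 / (real k + 1)\<^sup>2)" for k by simp
  have "(\<lambda>k. 6 / pi\<^sup>2 * (1 / (real k + 1)\<^sup>2)) sums (6 / pi\<^sup>2 * (pi\<^sup>2 / 6))"
    using inverse_squares_sums by (intro sums_mult) (simp add: add.commute)
  then have S: "(\<lambda>k. 6 / pi\<^sup>2 * (1 / (real k + 1)\<^sup>2)) sums 1" by simp
  have "(\<integral>\<^sup>+k. ennreal (6 / pi\<^sup>2 * (1 / (real k + 1)\<^sup>2)) \<partial>count_space UNIV)
      = (\<Sum>k. ennreal (6 / pi\<^sup>2 * (1 / (real k + 1)\<^sup>2)))"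
    by (rule nn_integral_count_space_nat)
  also have "\<dots> = ennreal (\<Sum>k. 6 / pi\<^sup>2 * (1 / (real k + 1)\<^sup>2))"
    by (rule suminf_ennreal2[OF _ sums_summable[OF S]]) simp
  also have "(\<Sum>k. 6 / pi\<^sup>2 * (1 / (real k + 1)\<^sup>2)) = 1"
    using S by (rule sums_unique[symmetric])
  finally show "(\<integral>\<^sup>+k. ennreal (6 / pi\<^sup>2 * (1 / (real k + 1)\<^sup>2)) \<partial>count_space UNIV) = 1"
    by simp
qed

(* The next lemmas show that the relational description of the algorithms is never vacuous. *)

lemma greedy_choice_exists:
  assumes N: "N \<ge> 1" and \<sigma>: "\<sigma> > 0" and u: "\<And>i. i < N \<Longrightarrow> u i \<ge> 0" and w: "\<And>i. i < N \<Longrightarrow> w i \<ge> 0"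
  shows "\<exists>y. greedy_choice N u w \<sigma> y"
proof -
  define A where "A = {i. i < N \<and> (u i > 0 \<or> w i > 0)}"
  define P where "P y = (\<Prod>i\<in>A. u i + w i * y i)" for y :: "nat \<Rightarrow> real"
  define B where "B = PiE UNIV (\<lambda>i. if i < N then {0..\<sigma>} else {0::real})"
  define K where "K = B \<inter> {y. (\<Sum>i<N. y i) \<le> \<sigma>}"
  have fA: "finite A" unfolding A_def by simp
  have AN: "i < N" if "i \<in> A" for i using that A_def by simp
  have "compactin (product_topology (\<lambda>i. euclidean) UNIV) B"
    unfolding B_def by (subst compactin_PiE) auto
  then have cB: "compact B" by (simp add: euclidean_product_topology)
  have "closed {y::nat \<Rightarrow> real. (\<Sum>i<N. y i) \<le> \<sigma>}"
    by (intro closed_Collect_le continuous_intros continuous_on_product_coordinates)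
  then have cK: "compact K" unfolding K_def using cB by (rule compact_Int_closed[rotated])
  define z0 where "z0 = (\<lambda>i. if i < N then \<sigma> / real N else 0)"
  have z0s: "(\<Sum>i<N. z0 i) = \<sigma>" unfolding z0_def using N by simp
  have "\<sigma> / real N \<le> \<sigma>" using N \<sigma> by (simp add: divide_le_eq)
  then have z0K: "z0 \<in> K" unfolding K_def B_def using z0s \<sigma> by (auto simp: z0_def)
  have cP: "continuous_on K P" unfolding P_def
    by (intro continuous_intros continuous_on_subset[OF continuous_on_product_coordinates]) auto
  obtain y where yK: "y \<in> K" and ymax: "\<And>z. z \<in> K \<Longrightarrow> P z \<le> P y"
    using continuous_attains_sup[OF cK _ cP] z0K by blast
  have "P z0 > 0" unfolding P_def
  proof (rule prod_pos)
    fix i assume i: "i \<in> A"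
    have z: "z0 i > 0" using N \<sigma> AN[OF i] by (simp add: z0_def)
    show "u i + w i * z0 i > 0"
    proof (cases "w i > 0")
      case True
      then show ?thesis using mult_pos_pos[OF True z] u[OF AN[OF i]] by linarith
    next
      case False
      then show ?thesis using i w[OF AN[OF i]] by (simp add: A_def)
    qed
  qed
  then have Py: "P y > 0" using ymax[OF z0K] by simp
  have ynn: "y i \<ge> 0" if "i < N" for i
    using yK that unfolding K_def B_def PiE_def Pi_def by (auto dest: spec[of _ i])
  have obj: "greedy_objective N u w z = ereal (ln (P z))"
    if "\<And>i. i \<in> A \<Longrightarrow> u i + w i * z i > 0" for z
  proof -
    have "greedy_objective N u w z = (\<Sum>i\<in>A. ereal (ln (u i + w i * z i)))"
      unfolding greedy_objective_def A_def[symmetric]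
      using that by (intro sum.cong) (auto simp: ext_ln_def not_le[symmetric])
    also have "\<dots> = ereal (ln (P z))"
      unfolding P_def using ln_prod[OF fA, of "\<lambda>i. u i + w i * z i"] that
    by (metis less_irrefl sum_ereal)
    finally show ?thesis .
  qed
  have nny: "u i + w i * y i \<ge> 0" if "i \<in> A" for i using AN[OF that] ynn u w by simp
  have posy: "u i + w i * y i > 0" if "i \<in> A" for i
  proof -
    have "u i + w i * y i \<noteq> 0" using Py prod_zero[OF fA, of "\<lambda>i. u i + w i * y i"] that
      unfolding P_def by fastforce
    then show ?thesis using nny[OF that] by simp
  qed
  have "greedy_objective N u w z \<le> greedy_objective N u w y" if z: "item_allocation N \<sigma> z" for z
  proof (cases "\<exists>i\<in>A. u i + w i * z i \<le> 0")
    case True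
    then obtain i where i: "i \<in> A" "ext_ln (u i + w i * z i) = -\<infinity>" by (auto simp: ext_ln_def)
    have "(\<Sum>i\<in>A. ext_ln (u i + w i * z i))
        = ext_ln (u i + w i * z i) + (\<Sum>i\<in>A - {i}. ext_ln (u i + w i * z i))"
      using i fA by (simp add: sum.remove)
    moreover have "(\<Sum>i\<in>A - {i}. ext_ln (u i + w i * z i)) \<noteq> \<infinity>"
      using fA by (auto simp: sum_Pinfty ext_ln_def split: if_splits)
    ultimately have "(\<Sum>i\<in>A. ext_ln (u i + w i * z i)) = -\<infinity>"
      using i(2) by simp
    then show ?thesis unfolding greedy_objective_def A_def[symmetric] by simp
  next
    case False
    then have posz: "u i + w i * z i > 0" if "i \<in> A" for i using that by force
    define z' where "z' = (\<lambda>i. if i < N then z i else 0)"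
    have znn: "z i \<ge> 0" if "i < N" for i using z that unfolding item_allocation_def by simp
    have zs: "(\<Sum>i<N. z i) \<le> \<sigma>" using z unfolding item_allocation_def by simp
    have "z i \<le> \<sigma>" if "i < N" for i
      using member_le_sum[of i "{..<N}" z] that znn zs by fastforce
    then have "z' \<in> K" unfolding K_def B_def z'_def using znn zs by auto
    moreover have "P z' = P z" unfolding P_def z'_def using AN by (intro prod.cong) auto
    ultimately have "P z \<le> P y" using ymax by metis
    moreover have "P z > 0" unfolding P_def using posz by (intro prod_pos) auto
    ultimately show ?thesis using obj[OF posz] obj[OF posy] by simp
  qed
  then have "greedy_choice N u w \<sigma> y"
    unfolding greedy_choice_def item_allocation_def using ynn yK by (auto simp: K_def)
  then show ?thesis by blast
qed

lemma myopic_greedy_exists: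
  assumes "valid_instance N T s v"
  shows "\<exists>x. myopic_greedy N T s v x"
  using assms
proof (induction T)
  case 0
  then show ?case by (simp add: myopic_greedy_def)
next
  case (Suc T)
  then have vi: "valid_instance N T s v" by (simp add: valid_instance_def)
  then obtain x where x: "myopic_greedy N T s v x" using Suc.IH by blast
  have "\<exists>y. greedy_choice N (utility T v x) (\<lambda>i. v i T) (s T) y"
  proof (rule greedy_choice_exists)
    show "1 \<le> N" "0 < s T" using Suc.prems by (auto simp: valid_instance_def)
    show "0 \<le> v i T" if "i < N" for i using Suc.prems that by (auto simp: valid_instance_def)
    show "0 \<le> utility T v x i" if "i < N" for i
      unfolding utility_def using that x vi
      by (intro sum_nonneg mult_nonneg_nonneg)
        (auto simp: valid_instance_def myopic_greedy_def greedy_choice_def item_allocation_def)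
  qed
  then obtain y where y: "greedy_choice N (utility T v x) (\<lambda>i. v i T) (s T) y" ..
  define x' where "x' = (\<lambda>i t. if t = T then y i else x i t)"
  have U: "utility t v x' = utility t v x" if "t \<le> T" for t
    unfolding utility_def x'_def using that by (intro ext sum.cong) auto
  have "greedy_choice N (utility t v x') (\<lambda>i. v i t) (s t) (\<lambda>i. x' i t)" if "t < Suc T" for t
  proof (cases "t = T")
    case True
    then show ?thesis using y U[of T] by (simp add: x'_def)
  next
    case False
    then show ?thesis using x U[of t] that by (simp add: x'_def myopic_greedy_def)
  qed
  then show ?case unfolding myopic_greedy_def by blast
qed

lemma greedy_rounded_exists:
  assumes "valid_instance N T s v"
  shows "\<exists>x. greedy_rounded N T s v \<mu> x"
proof -
  define L where "L = num_levels \<mu>"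
  have v0: "max_value N v t \<ge> 0" if "t < T" for t
  proof -
    have "v 0 t \<le> max_value N v t" "0 \<le> v 0 t"
      using assms that unfolding max_value_def valid_instance_def by (auto intro!: Max_ge)
    then show ?thesis by linarith
  qed
  have lt: "r div L < T" "L > 0" if "r < T * L" for r
    using that by (auto simp: less_mult_imp_div_less intro: Nat.gr0I)
  have "valid_instance N (T * L) (sub_supply L s) (sub_value N L v)"
    using assms lt v0 unfolding valid_instance_def sub_supply_def sub_value_def Let_def by auto
  then obtain y where "myopic_greedy N (T * L) (sub_supply L s) (sub_value N L v) y"
    using myopic_greedy_exists by blast
  then show ?thesis unfolding greedy_rounded_def Let_def L_def[symmetric]
    by (intro exI[of _ "\<lambda>i t. \<Sum>j=1..L. y i (t * L + (j - 1))"] exI[of _ y]) auto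
qed

end

(* Fix a Nash welfare maximizing allocation with utilities U_i. Its optimality conditions give
   v_jt / U_j <= v_it / U_i whenever agent i receives some of item t, so in an impartial instance
   with ratio at most 2^L she values t at least max_j v_jt / 2^L. Hence splitting every item equally
   among its L sub-items leaves her with rounded utility at least w_i = U_i / (2L).

   On the sub-items, which all agents interested in them value equally, Myopic Greedy is
   water-filling. If u_i are its final utilities then, for every d, the agents with u_i <= d satisfy
   sum w_i <= N d, as all items that interest them went to agents of current utility at most d.
   Ordering the agents by u_i, this bounds u_k below by the k-th prefix sum of w divided by N, and
   prod w_i <= (4 ln(1 + 2^L))^N prod u_i follows by AM-GM. The algorithm with L levels thus loses a
   factor of at most 16 L^2.

   If M is the impartiality ratio, some k <= 1 + log log M has M <= 2^(2^k) and 2^k <= 2 log M; it is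
   guessed with probability of order 1/(log log M)^2. *)

theory Submission
  imports Defs
begin

section \<open>First-order conditions for maximizing a product of affine utilities over one
  item\<close>

text \<open>Moving \<open>e\<close> units from \<open>i\<close> to \<open>j\<close> changes the
  product of their two factors by \<open>e * (w j * U i - w i * U j) - e^2 * w i * w j\<close>,
  whose linear part cannot be positive at a maximum. It is applied both to the greedy choice and to
  the offline optimum.\<close>

lemma max_product_transfer:
  fixes b w y :: "nat \<Rightarrow> real"
  assumes y: "item_allocation N \<sigma> y"
    and opt: "\<And>z. item_allocation N \<sigma> z \<Longrightarrow> (\<Prod>i<N. b i + w i * z i) \<le> (\<Prod>i<N. b i + w i * y i)"
    and pos: "\<And>i. i < N \<Longrightarrow> b i + w i * y i > 0"
    and w: "\<And>i. i < N \<Longrightarrow> w i \<ge> 0"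
    and ij: "i < N" "j < N" "y i > 0"
  shows "w j * (b i + w i * y i) \<le> w i * (b j + w j * y j)"
proof (cases "i = j")
  case False
  define U where "U i = b i + w i * y i" for i
  have Upos: "U l > 0" if "l < N" for l using pos that by (simp add: U_def)
  show ?thesis
  proof (rule ccontr)
    assume "\<not> ?thesis"
    then have d: "w j * U i - w i * U j > 0" by (simp add: U_def)
    define d where "d = w j * U i - w i * U j"
    \<comment> \<open>The first bound keeps \<open>z i\<close> non-negative; the second, with
      \<open>+ 1\<close> guarding against \<open>w i * w j = 0\<close>, gives
      \<open>d - e * (w i * w j) \<ge> e > 0\<close>.\<close>
    define e where "e = min (y i) (d / (w i * w j + 1))"
    have ww: "w i * w j \<ge> 0" using w ij by simp
    have e: "e > 0" "e \<le> y i" "e * (w i * w j + 1) \<le> d"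
    proof -
      show "e > 0" using d ij ww by (simp add: e_def d_def add_nonneg_pos)
      show "e \<le> y i" by (simp add: e_def)
      have "e * (w i * w j + 1) \<le> d / (w i * w j + 1) * (w i * w j + 1)"
        using ww by (intro mult_right_mono) (auto simp: e_def)
      then show "e * (w i * w j + 1) \<le> d" using ww by simp
    qed
    define z where "z = y(i := y i - e, j := y j + e)"
    define R where "R = (\<Prod>l\<in>{..<N} - {i} - {j}. U l)"
    have R: "R > 0" unfolding R_def using Upos by (intro prod_pos) auto
    have split: "(\<Prod>l<N. f l) = f i * (f j * (\<Prod>l\<in>{..<N} - {i} - {j}. f l))" for f :: "nat \<Rightarrow> real"
      using ij False by (simp add: prod.remove[of _ i] prod.remove[of _ j])
    have split_sum: "(\<Sum>l<N. f l) = f i + (f j + (\<Sum>l\<in>{..<N} - {i} - {j}. f l))" for f :: "nat \<Rightarrow> real"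
      using ij False by (simp add: sum.remove[of _ i] sum.remove[of _ j])
    have "(\<Sum>l<N. z l) = (\<Sum>l<N. y l)"
      unfolding split_sum using False by (simp add: z_def)
    then have z: "item_allocation N \<sigma> z"
      using y e ij by (auto simp: item_allocation_def z_def)
    have "(\<Prod>l\<in>{..<N} - {i} - {j}. b l + w l * z l) = R"
      unfolding R_def U_def by (intro prod.cong) (auto simp: z_def)
    then have "(\<Prod>l<N. b l + w l * z l) = (U i - w i * e) * ((U j + w j * e) * R)"
      unfolding split using False by (simp add: z_def U_def algebra_simps)
    moreover have "(\<Prod>l<N. b l + w l * y l) = U i * (U j * R)"
      unfolding split R_def U_def ..
    ultimately have "((U i - w i * e) * (U j + w j * e)) * R \<le> (U i * U j) * R"
      using opt[OF z] by (simp add: mult.assoc)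
    then have "(U i - w i * e) * (U j + w j * e) \<le> U i * U j" using R by simp
    then have "e * (d - e * (w i * w j)) \<le> 0" unfolding d_def by (simp add: algebra_simps)
    moreover have "d - e * (w i * w j) > 0" using e by (simp add: algebra_simps)
    ultimately show False using e by (meson mult_pos_pos not_less)
  qed
qed simp

text \<open>All factors being positive, handing leftover supply to an agent with positive
  \<open>w\<close> would strictly increase the product.\<close>

lemma max_product_exhausts_supply:
  fixes b w y :: "nat \<Rightarrow> real"
  assumes y: "item_allocation N \<sigma> y"
    and opt: "\<And>z. item_allocation N \<sigma> z \<Longrightarrow> (\<Prod>i<N. b i + w i * z i) \<le> (\<Prod>i<N. b i + w i * y i)"
    and pos: "\<And>i. i < N \<Longrightarrow> b i + w i * y i > 0"
    and i: "i < N" "w i > 0"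
  shows "(\<Sum>i<N. y i) = \<sigma>"
proof (rule ccontr)
  assume "(\<Sum>i<N. y i) \<noteq> \<sigma>"
  then have e: "\<sigma> - (\<Sum>i<N. y i) > 0" using y by (simp add: item_allocation_def)
  define e where "e = \<sigma> - (\<Sum>i<N. y i)"
  define z where "z = y(i := y i + e)"
  have "(\<Sum>l<N. z l) = \<sigma>"
    using i by (simp add: sum.remove[of _ i] z_def e_def)
  then have z: "item_allocation N \<sigma> z"
    using y e i by (auto simp: item_allocation_def z_def e_def)
  have R: "(\<Prod>l\<in>{..<N} - {i}. b l + w l * y l) > 0" using pos by (intro prod_pos) auto
  have "(\<Prod>l\<in>{..<N} - {i}. b l + w l * z l) = (\<Prod>l\<in>{..<N} - {i}. b l + w l * y l)"
    by (intro prod.cong) (auto simp: z_def)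
  then have "b i + w i * z i \<le> b i + w i * y i"
    using opt[OF z] i R by (simp add: prod.remove[of _ i])
  then show False using e i by (simp add: z_def e_def)
qed

section \<open>Myopic Greedy as product maximization and water-filling\<close>

text \<open>An agent left out of the objective gets base 1; as her \<open>w\<close> is 0, her factor
  is 1 and adds \<open>ln 1 = 0\<close>. The extended-real sum thus becomes the logarithm of a
  product over all agents.\<close>

lemma greedy_objective_eq_ln:
  assumes "\<And>i. i < N \<Longrightarrow> (if u i > 0 \<or> w i > 0 then u i else 1) + w i * z i > 0"
    and w: "\<And>i. i < N \<Longrightarrow> w i \<ge> 0"
  shows "greedy_objective N u w z
    = ereal (ln (\<Prod>i<N. (if u i > 0 \<or> w i > 0 then u i else 1) + w i * z i))"
proof -
  let ?A = "{i. i < N \<and> (u i > 0 \<or> w i > 0)}"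
  let ?f = "\<lambda>i. (if u i > 0 \<or> w i > 0 then u i else 1) + w i * z i"
  have pos: "?f i > 0" if "i < N" for i using assms(1)[OF that] .
  have "greedy_objective N u w z = (\<Sum>i\<in>?A. ereal (ln (?f i)))"
    unfolding greedy_objective_def
  proof (intro sum.cong refl)
    fix i assume "i \<in> ?A"
    then show "ext_ln (u i + w i * z i) = ereal (ln (?f i))"
      using pos[of i] by (simp add: ext_ln_def split: if_splits)
  qed
  also have "\<dots> = ereal (\<Sum>i\<in>?A. ln (?f i))" by simp
  also have "(\<Sum>i\<in>?A. ln (?f i)) = (\<Sum>i<N. ln (?f i))"
  proof (intro sum.mono_neutral_left ballI)
    fix i assume i: "i \<in> {..<N} - ?A"
    then have "w i = 0" using w[of i] by force
    then show "ln (?f i) = 0" using i by simp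
  qed auto
  also have "\<dots> = ln (\<Prod>i<N. ?f i)"
    using ln_prod[of "{..<N}" ?f] pos by (metis finite_lessThan lessThan_iff less_irrefl)
  finally show ?thesis .
qed

text \<open>The equal split makes all factors positive, so a greedy choice cannot have objective
  \<open>-\<infinity>\<close> and its own factors are positive too. On positive products
  \<open>ln\<close> preserves the order, which makes the first-order conditions applicable.\<close>

lemma greedy_choice_maximizes_product:
  fixes u w y :: "nat \<Rightarrow> real"
  defines "b \<equiv> \<lambda>i. if u i > 0 \<or> w i > 0 then u i else 1"
  assumes g: "greedy_choice N u w \<sigma> y" and \<sigma>: "\<sigma> > 0" 
    and u: "\<And>i. i < N \<Longrightarrow> u i \<ge> 0" and w: "\<And>i. i < N \<Longrightarrow> w i \<ge> 0"
  shows "\<And>i. i < N \<Longrightarrow> b i + w i * y i > 0"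
    and "\<And>z. item_allocation N \<sigma> z \<Longrightarrow> (\<Prod>i<N. b i + w i * z i) \<le> (\<Prod>i<N. b i + w i * y i)"
proof -
  have alloc_pos: "i < N \<Longrightarrow> b i + w i * z i \<ge> 0" if "item_allocation N \<sigma> z" for z i
    using that u w by (auto simp: b_def item_allocation_def)
  have obj: "greedy_objective N u w z = ereal (ln (\<Prod>i<N. b i + w i * z i))"
    if "\<And>i. i < N \<Longrightarrow> b i + w i * z i > 0" for z
    unfolding b_def using that w by (intro greedy_objective_eq_ln) (auto simp: b_def)
  show pos: "b i + w i * y i > 0" if i: "i < N" for i
  proof (rule ccontr)
    assume np: "\<not> ?thesis"
    define z0 where "z0 = (\<lambda>i::nat. \<sigma> / real N)"
    have z0: "item_allocation N \<sigma> z0" using \<sigma> i by (simp add: item_allocation_def z0_def)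
    have "b l + w l * z0 l > 0" if l: "l < N" for l
    proof (cases "w l > 0")
      case True
      then have "w l * z0 l > 0" using \<sigma> i by (simp add: z0_def)
      then show ?thesis using u[OF l] True by (simp add: b_def)
    qed (use w[OF l] u[OF l] in \<open>auto simp: b_def\<close>)
    then have "greedy_objective N u w z0 \<noteq> -\<infinity>" using obj[of z0] by simp
    then have fin: "greedy_objective N u w y \<noteq> -\<infinity>"
      using g z0 unfolding greedy_choice_def by (metis ereal_infty_less_eq(2))
    have iA: "i \<in> {i. i < N \<and> (u i > 0 \<or> w i > 0)}" "ext_ln (u i + w i * y i) = -\<infinity>"
      using np i w[OF i] by (auto simp: ext_ln_def b_def split: if_splits)
    \<comment> \<open>In \<open>ereal\<close>, \<open>\<infinity> + -\<infinity>\<close> is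
      \<open>\<infinity>\<close>, so the remaining terms must be kept from reaching
      \<open>\<infinity>\<close> before one term can pull the sum down to
      \<open>-\<infinity>\<close>.\<close>
    moreover have "(\<Sum>i\<in>{i. i < N \<and> (u i > 0 \<or> w i > 0)} - {i}. ext_ln (u i + w i * y i)) \<noteq> \<infinity>"
      by (auto simp: sum_Pinfty ext_ln_def split: if_splits)
    ultimately have "greedy_objective N u w y = -\<infinity>"
      unfolding greedy_objective_def by (subst sum.remove[OF _ iA(1)]) auto
    then show False using fin by simp
  qed
  show "(\<Prod>i<N. b i + w i * z i) \<le> (\<Prod>i<N. b i + w i * y i)" if z: "item_allocation N \<sigma> z" for z
  proof (cases "\<exists>i<N. b i + w i * z i = 0")
    case True
    then have "(\<Prod>i<N. b i + w i * z i) = 0" by (auto intro!: prod_zero)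
    moreover have "(\<Prod>i<N. b i + w i * y i) > 0" using pos by (intro prod_pos) auto
    ultimately show ?thesis by linarith
  next
    case False
    then have pz: "b i + w i * z i > 0" if "i < N" for i
      using alloc_pos[OF z that] that by (simp add: order_less_le) metis
    have "greedy_objective N u w z \<le> greedy_objective N u w y"
      using g z by (simp add: greedy_choice_def)
    moreover have "(\<Prod>i<N. b i + w i * y i) > 0" "(\<Prod>i<N. b i + w i * z i) > 0"
      using pos pz by (auto intro!: prod_pos)
    ultimately show ?thesis using obj[OF pos] obj[OF pz] by simp
  qed
qed

text \<open>With a single positive value \<open>a\<close>, uninterested agents receive nothing and
  \<open>a\<close> cancels from the first-order condition, leaving a comparison of levels after the
  item.\<close>

lemma greedy_choice_water_filling:
  fixes u w y :: "nat \<Rightarrow> real"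
  assumes g: "greedy_choice N u w \<sigma> y" and \<sigma>: "\<sigma> > 0" 
    and u: "\<And>i. i < N \<Longrightarrow> u i \<ge> 0" and w: "\<And>i. i < N \<Longrightarrow> w i = 0 \<or> w i = a" and a: "a > 0"
    and i: "i < N" "w i = a"
  shows "(\<Sum>j<N. w j * y j) = a * \<sigma>"
    and "\<And>j. j < N \<Longrightarrow> w j * y j > 0 \<Longrightarrow> u j + w j * y j \<le> u i + w i * y i"
proof -
  define b where "b = (\<lambda>i. if u i > 0 \<or> w i > 0 then u i else 1)"
  have w0: "w j \<ge> 0" if "j < N" for j using w[OF that] a by auto
  have y: "item_allocation N \<sigma> y" using g by (simp add: greedy_choice_def)
  have mp: "i < N \<Longrightarrow> b i + w i * y i > 0"
      "item_allocation N \<sigma> z \<Longrightarrow> (\<Prod>i<N. b i + w i * z i) \<le> (\<Prod>i<N. b i + w i * y i)" for i z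
    unfolding b_def using greedy_choice_maximizes_product[OF g \<sigma> u w0] by blast+
  have tr: "w i * (b j + w j * y j) \<le> w j * (b i + w i * y i)" if "j < N" "y j > 0" for j
    using max_product_transfer[OF y mp(2) mp(1) w0] that i by auto
  \<comment> \<open>If \<open>w j = 0\<close>, the transfer condition would force \<open>a\<close>
    times the positive factor of \<open>j\<close> to be at most 0.\<close>
  have wy: "w j = a" if "j < N" "y j > 0" for j
  proof (rule ccontr)
    assume "w j \<noteq> a"
    then have "w j = 0" using w that by auto
    then show False using tr[OF that] mp(1)[OF that(1)] i a by (simp add: mult_le_0_iff)
  qed
  have "(\<Sum>j<N. w j * y j) = (\<Sum>j<N. a * y j)"
  proof (intro sum.cong refl)
    fix j assume "j \<in> {..<N}"
    then show "w j * y j = a * y j" using wy[of j] y by (cases "y j > 0") (auto simp: item_allocation_def)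
  qed
  also have "\<dots> = a * \<sigma>"
    using max_product_exhausts_supply[OF y mp(2) mp(1), of i] i a by (simp flip: sum_distrib_left)
  finally show "(\<Sum>j<N. w j * y j) = a * \<sigma>" .
  show "u j + w j * y j \<le> u i + w i * y i" if j: "j < N" "w j * y j > 0" for j
  proof -
    have "y j \<ge> 0" using y j by (auto simp: item_allocation_def)
    then have yj: "y j > 0" using j by (metis less_eq_real_def mult_zero_right)
    show ?thesis using tr[OF j(1) yj] wy[OF j(1) yj] i a by (simp add: b_def)
  qed
qed

text \<open>Every item valued by a poor agent is used up by agents who are themselves still poor
  at that time, and each of them can absorb at most \<open>\<delta>\<close> before becoming rich.\<close>

lemma poor_agents_bound:
  assumes valid: "valid_instance N T s v"
    and single: "\<And>t. t < T \<Longrightarrow> \<exists>a. \<forall>i<N. v i t = 0 \<or> v i t = a"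
    and greedy: "myopic_greedy N T s v x" and z: "allocation N T s z" and \<delta>: "\<delta> \<ge> 0"
  shows "(\<Sum>i | i < N \<and> utility T v x i \<le> \<delta>. utility T v z i) \<le> real N * \<delta>"
proof -
  define B where "B = {i. i < N \<and> utility T v x i \<le> \<delta>}"
  define D where "D = {t. t < T \<and> (\<exists>i\<in>B. v i t > 0)}"
  have v: "v i t \<ge> 0" if "i < N" "t < T" for i t using valid that by (simp add: valid_instance_def)
  have x: "x i t \<ge> 0" if "i < N" "t < T" for i t
    using greedy that by (simp add: myopic_greedy_def greedy_choice_def item_allocation_def)
  have vx: "v i t * x i t \<ge> 0" if "i < N" "t < T" for i t using v x that by simp
  have util_mono: "utility t v x i \<le> utility t' v x i" if "i < N" "t \<le> t'" "t' \<le> T" for i t t'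
    unfolding utility_def using that vx by (intro sum_mono2) auto
  \<comment> \<open>Greedy extracts \<open>a * s t\<close> from an item of \<open>D\<close>, at
    least what \<open>z\<close> extracts for poor agents. By water-filling, right after the item its
    recipients are no higher than the poor agent who values it.\<close>
  have fill: "(\<Sum>i\<in>B. v i t * z i t) \<le> (\<Sum>j<N. v j t * x j t) \<and>
    (\<forall>j<N. v j t * x j t > 0 \<longrightarrow> utility (Suc t) v x j \<le> \<delta>)" if "t \<in> D" for t
  proof -
    from that obtain i where t: "t < T" and i: "i < N" "utility T v x i \<le> \<delta>" "v i t > 0"
      by (auto simp: D_def B_def)
    then obtain a where a: "\<And>i. i < N \<Longrightarrow> v i t = 0 \<or> v i t = a" using single by blast
    then have ia: "v i t = a" "a > 0" using i by force+
    have g: "greedy_choice N (utility t v x) (\<lambda>i. v i t) (s t) (\<lambda>i. x i t)"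
      using greedy t by (simp add: myopic_greedy_def)
    have \<sigma>: "s t > 0" using valid t by (simp add: valid_instance_def)
    have u: "utility t v x i \<ge> 0" if "i < N" for i
      using util_mono[of i 0 t] that t by (simp add: utility_def)
    have wf: "(\<Sum>j<N. v j t * x j t) = a * s t"
      "\<And>j. j < N \<Longrightarrow> v j t * x j t > 0 \<Longrightarrow>
        utility t v x j + v j t * x j t \<le> utility t v x i + v i t * x i t"
      using greedy_choice_water_filling[OF g \<sigma> u a ia(2) i(1) ia(1)] by blast+
    have zt: "item_allocation N (s t) (\<lambda>i. z i t)" using z t by (simp add: allocation_def)
    have "(\<Sum>i\<in>B. v i t * z i t) \<le> (\<Sum>i<N. a * z i t)"
    proof -
      have "(\<Sum>i\<in>B. v i t * z i t) \<le> (\<Sum>i<N. v i t * z i t)"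
        using zt v t by (intro sum_mono2) (auto simp: B_def item_allocation_def)
      also have "\<dots> \<le> (\<Sum>i<N. a * z i t)"
        using zt v t a ia by (intro sum_mono mult_right_mono) (force simp: item_allocation_def)+
      finally show ?thesis .
    qed
    also have "\<dots> \<le> a * s t"
      using zt ia by (simp add: item_allocation_def flip: sum_distrib_left)
    also have "\<dots> = (\<Sum>j<N. v j t * x j t)" using wf(1) by simp
    finally have "(\<Sum>i\<in>B. v i t * z i t) \<le> (\<Sum>j<N. v j t * x j t)" .
    moreover have "utility (Suc t) v x j \<le> \<delta>" if "j < N" "v j t * x j t > 0" for j
    proof -
      have "utility (Suc t) v x j \<le> utility (Suc t) v x i"
        using wf(2)[OF that] by (simp add: utility_def)
      also have "\<dots> \<le> utility T v x i" using util_mono i t by simp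
      finally show ?thesis using i by simp
    qed
    ultimately show ?thesis by blast
  qed
  have capped: "(\<Sum>t\<in>D. v j t * x j t) \<le> \<delta>" if j: "j < N" for j
  proof -
    define E where "E = {t\<in>D. v j t * x j t > 0}"
    have "finite E" by (simp add: E_def D_def)
    have "(\<Sum>t\<in>D. v j t * x j t) = (\<Sum>t\<in>E. v j t * x j t)"
      using vx[OF j] by (intro sum.mono_neutral_right) (force simp: E_def D_def)+
    also have "\<dots> \<le> \<delta>"
    proof (cases "E = {}")
      case False
      \<comment> \<open>Agent \<open>j\<close> may finish above \<open>\<delta>\<close>, but right
        after her last gain from \<open>D\<close> she does not exceed it, and her utility then
        includes all her gains from \<open>D\<close>.\<close>
      define t0 where "t0 = Max E"
      have t0: "t0 \<in> E" "\<And>t. t \<in> E \<Longrightarrow> t \<le> t0"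
        using \<open>finite E\<close> False by (auto simp: t0_def)
      then have "(\<Sum>t\<in>E. v j t * x j t) \<le> utility (Suc t0) v x j"
        unfolding utility_def using vx[OF j]
        by (intro sum_mono2) (force simp: E_def D_def)+
      also have "\<dots> \<le> \<delta>" using t0(1) fill j by (auto simp: E_def)
      finally show ?thesis .
    qed (use \<delta> in simp)
    finally show ?thesis .
  qed
  \<comment> \<open>Charging argument: items outside \<open>D\<close> are worth nothing to poor
    agents, and greedy hands out at most \<open>\<delta>\<close> per agent on
    \<open>D\<close>.\<close>
  have "(\<Sum>i\<in>B. utility T v z i) = (\<Sum>t<T. \<Sum>i\<in>B. v i t * z i t)"
    unfolding utility_def by (rule sum.swap)
  also have "\<dots> = (\<Sum>t\<in>D. \<Sum>i\<in>B. v i t * z i t)"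
  proof (intro sum.mono_neutral_right ballI)
    fix t assume "t \<in> {..<T} - D"
    then have "v i t = 0" if "i \<in> B" for i
      using that v[of i t] by (force simp: D_def B_def)
    then show "(\<Sum>i\<in>B. v i t * z i t) = 0" by simp
  qed (auto simp: D_def)
  also have "\<dots> \<le> (\<Sum>t\<in>D. \<Sum>j<N. v j t * x j t)"
    using fill by (intro sum_mono) auto
  also have "\<dots> = (\<Sum>j<N. \<Sum>t\<in>D. v j t * x j t)" by (rule sum.swap)
  also have "\<dots> \<le> (\<Sum>j<N. \<delta>)" using capped by (intro sum_mono) auto
  finally show ?thesis by (simp add: B_def)
qed

section \<open>Bounding a product through prefix sums\<close>

text \<open>The first \<open>n\<close> factors \<open>(N + k + 1) / (k + 1)\<close> multiply to
  \<open>(N + n) choose n\<close>, which at \<open>n = N\<close> is the central binomial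
  coefficient.\<close>

lemma prod_one_plus_div_le: "(\<Prod>k<N. 1 + real N / real (Suc k)) \<le> 4 ^ N"
proof -
  have "(\<Prod>k<n. 1 + real N / real (Suc k)) = real ((N + n) choose n)" for n
  proof (induction n)
    case (Suc n)
    have "real (Suc (N + n)) * real ((N + n) choose n) = real ((N + Suc n) choose Suc n) * real (Suc n)"
      using Suc_times_binomial_eq[of "N + n" n] by (metis add_Suc_right of_nat_mult)
    then show ?case using Suc by (simp add: field_simps)
  qed simp
  then have "(\<Prod>k<N. 1 + real N / real (Suc k)) = real ((N + N) choose N)" .
  also have "\<dots> \<le> real (2 ^ (N + N))" by (intro of_nat_mono binomial_le_pow2)
  also have "\<dots> = 4 ^ N" by (simp flip: mult_2 add: power_mult)
  finally show ?thesis .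
qed

text \<open>AM-GM raised to the power \<open>N\<close>, a root-free form that combines directly with
  other products.\<close>

lemma prod_le_mean_power:
  fixes q :: "nat \<Rightarrow> real"
  assumes N: "N > 0" and q: "\<And>k. k < N \<Longrightarrow> q k \<ge> 0"
  shows "(\<Prod>k<N. q k) \<le> ((\<Sum>k<N. q k) / real N) ^ N"
proof -
  have P: "(\<Prod>k<N. q k) \<ge> 0" using q by (intro prod_nonneg) auto
  have "root N (\<Prod>k<N. q k) \<le> (\<Sum>k<N. q k) / real N"
    using arith_geom_mean[of "{..<N}" q] N q P root_powr_inverse[of N "\<Prod>k<N. q k"]
    by (simp add: sum_divide_distrib lessThan_empty_iff)
  then have "root N (\<Prod>k<N. q k) ^ N \<le> ((\<Sum>k<N. q k) / real N) ^ N"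
    using N P by (intro power_mono) auto
  then show ?thesis using N P by simp
qed

text \<open>With \<open>W\<^sub>k\<close> the prefix sums of \<open>w\<close>, write \<open>w\<^sub>k\<close> as the product of \<open>w\<^sub>k / (W\<^sub>k + N m)\<close>,
  \<open>(W\<^sub>k + N m) / W\<^sub>k\<close> and \<open>W\<^sub>k\<close>. The shift by \<open>N m\<close> makes the first factors sum to at most
  \<open>ln (1 + \<mu>)\<close>, with no dependence on \<open>N\<close>, while the second ones multiply to at most \<open>4 ^ N\<close>.\<close>

lemma prod_le_of_prefix_sums:
  fixes u w :: "nat \<Rightarrow> real"
  assumes N: "N > 0" and m: "m > 0"
    and w: "\<And>k. k < N \<Longrightarrow> m \<le> w k" "\<And>k. k < N \<Longrightarrow> w k \<le> \<mu> * m"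
    and prefix: "\<And>k. k < N \<Longrightarrow> (\<Sum>j\<le>k. w j) \<le> real N * u k"
  shows "(\<Prod>k<N. w k) \<le> (4 * ln (1 + \<mu>)) ^ N * (\<Prod>k<N. u k)"
proof -
  define W where "W k = (\<Sum>j\<le>k. w j)" for k
  \<comment> \<open>\<open>V k\<close> stops before \<open>k\<close>, so \<open>V (Suc k)\<close> is
    the shifted \<open>W k\<close>, and consecutive values differ by \<open>w k\<close>.\<close>
  define V where "V k = real N * m + (\<Sum>j<k. w j)" for k
  have w0: "w k > 0" if "k < N" for k using w(1)[OF that] m by linarith
  have W: "W k \<ge> real (Suc k) * m" if "k < N" for k
    unfolding W_def using sum_mono[of "{..k}" "\<lambda>_. m" w] w(1) that by simp
  have W0: "W k > 0" if "k < N" for k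
    using W[OF that] m by (smt (verit) mult_pos_pos of_nat_0_less_iff zero_less_Suc)
  have V0: "V k > 0" if "k \<le> N" for k
    unfolding V_def using N m w0 that
    by (intro add_pos_nonneg sum_nonneg) (auto intro: less_imp_le)
  have VW: "V (Suc k) = W k + real N * m" for k by (simp add: V_def W_def lessThan_Suc_atMost)
  define q where "q k = w k / V (Suc k)" for k
  have q: "q k \<ge> 0" if "k < N" for k using w0[OF that] V0[of "Suc k"] that by (simp add: q_def)
  have "\<mu> * m \<ge> m" using w[OF N] by linarith
  then have \<mu>: "\<mu> \<ge> 1" using m by simp
  \<comment> \<open>Each \<open>q k\<close> is \<open>(V (Suc k) - V k) / V (Suc k)\<close>, at most
    the increment of \<open>ln\<close> along \<open>V\<close>; these increments telescope.\<close>
  have "(\<Sum>k<N. q k) \<le> (\<Sum>k<N. ln (V (Suc k)) - ln (V k))"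
  proof (intro sum_mono)
    fix k assume "k \<in> {..<N}"
    then have V: "V k > 0" "V (Suc k) > 0" using V0 by auto
    have "ln (V k) - ln (V (Suc k)) \<le> (V k - V (Suc k)) / V (Suc k)" using V by (rule ln_diff_le)
    also have "V k - V (Suc k) = - w k" by (simp add: V_def)
    finally show "q k \<le> ln (V (Suc k)) - ln (V k)" by (simp add: q_def)
  qed
  also have "\<dots> = ln (V N) - ln (V 0)" by (rule sum_lessThan_telescope)
  also have "\<dots> = ln (V N / V 0)" using V0[of 0] V0[of N] by (simp add: ln_div)
  also have "\<dots> \<le> ln (1 + \<mu>)"
  proof -
    \<comment> \<open>\<open>V 0\<close> is the shift \<open>N * m\<close>, to which at most
      \<open>N * \<mu> * m\<close> is added; so \<open>N\<close> cancels from the ratio.\<close>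
    have "V N \<le> (1 + \<mu>) * V 0"
      using sum_mono[of "{..<N}" w "\<lambda>_. \<mu> * m"] w(2) by (simp add: V_def algebra_simps)
    then have "V N / V 0 \<le> 1 + \<mu>" using V0[of 0] by (simp add: pos_divide_le_eq)
    then show ?thesis using V0[of 0] V0[of N] by (intro ln_mono) auto
  qed
  finally have sumq: "(\<Sum>k<N. q k) \<le> ln (1 + \<mu>)" .
  have factor: "w k \<le> q k * (1 + real N / real (Suc k)) * (real N * u k)" if k: "k < N" for k
  proof -
    have "V (Suc k) = W k + real N * m" by (rule VW)
    \<comment> \<open>As \<open>W k\<close> is at least \<open>(k + 1) * m\<close>, the shift is at
      most a fraction \<open>N / (k + 1)\<close> of \<open>W k\<close>.\<close>
    also have "\<dots> \<le> W k * (1 + real N / real (Suc k))"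
    proof -
      have "real N * m * real (Suc k) \<le> real N * W k"
        using W[OF k] mult_left_mono[OF W[OF k], of "real N"] by (simp add: mult_ac)
      then have "real N * m \<le> real N * W k / real (Suc k)"
        by (simp only: pos_le_divide_eq of_nat_0_less_iff zero_less_Suc)
      then show ?thesis by (simp add: distrib_left mult.commute)
    qed
    also have "\<dots> \<le> real N * u k * (1 + real N / real (Suc k))"
      using prefix[OF k] by (intro mult_right_mono) (auto simp: W_def)
    finally have "q k * V (Suc k) \<le> q k * (real N * u k * (1 + real N / real (Suc k)))"
      using q[OF k] by (intro mult_left_mono)
    then show ?thesis using V0[of "Suc k"] k by (simp add: q_def mult_ac)
  qed
  have u0: "u k \<ge> 0" if "k < N" for k
  proof -
    have "real N * u k > 0" using prefix[OF that] W0[OF that] unfolding W_def by linarith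
    then show ?thesis by (simp add: zero_less_mult_iff)
  qed
  have "(\<Prod>k<N. w k) \<le> (\<Prod>k<N. q k * (1 + real N / real (Suc k)) * (real N * u k))"
    using factor w0 by (intro prod_mono) (auto intro: less_imp_le)
  also have "\<dots> = (\<Prod>k<N. q k) * (\<Prod>k<N. 1 + real N / real (Suc k)) * (real N ^ N * (\<Prod>k<N. u k))"
    by (simp add: prod.distrib)
  also have "\<dots> \<le> (ln (1 + \<mu>) / real N) ^ N * 4 ^ N * (real N ^ N * (\<Prod>k<N. u k))"
  proof (intro mult_right_mono mult_mono prod_one_plus_div_le)
    have "(\<Prod>k<N. q k) \<le> ((\<Sum>k<N. q k) / real N) ^ N" using N q by (rule prod_le_mean_power)
    also have "\<dots> \<le> (ln (1 + \<mu>) / real N) ^ N"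
      using sumq q by (intro power_mono divide_right_mono divide_nonneg_nonneg sum_nonneg) auto
    finally show "(\<Prod>k<N. q k) \<le> (ln (1 + \<mu>) / real N) ^ N" .
  qed (use \<mu> u0 in \<open>auto intro!: prod_nonneg mult_nonneg_nonneg\<close>)
  also have "\<dots> = (4 * ln (1 + \<mu>)) ^ N * (\<Prod>k<N. u k)"
    using N by (simp add: power_divide power_mult_distrib)
  finally show ?thesis .
qed

text \<open>Sorting by \<open>u\<close> places the first \<open>k + 1\<close> agents inside the
  lower level set of the agent at position \<open>k\<close>, so level-set sums bound prefix sums.
  Ties can only enlarge the level set, which is harmless as \<open>w\<close> is positive.\<close>

lemma prod_le_of_lower_level_sums:
  fixes u w :: "nat \<Rightarrow> real"
  assumes N: "N > 0" and m: "m > 0"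
    and w: "\<And>i. i < N \<Longrightarrow> m \<le> w i" "\<And>i. i < N \<Longrightarrow> w i \<le> \<mu> * m"
    and lower: "\<And>k. k < N \<Longrightarrow> (\<Sum>i | i < N \<and> u i \<le> u k. w i) \<le> real N * u k"
  shows "(\<Prod>i<N. w i) \<le> (4 * ln (1 + \<mu>)) ^ N * (\<Prod>i<N. u i)"
proof -
  define xs where "xs = sort_key u [0..<N]"
  define p where "p = (\<lambda>k. xs ! k)"
  have xs: "distinct xs" "length xs = N" "set xs = {..<N}" "sorted (map u xs)"
    by (auto simp: xs_def)
  have p: "bij_betw p {..<N} {..<N}"
    unfolding p_def using xs by (intro bij_betw_nth) simp_all
  have pN: "p k < N" if "k < N" for k using bij_betwE[OF p] that by auto
  have mono: "u (p j) \<le> u (p k)" if "j \<le> k" "k < N" for j k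
    using sorted_nth_mono[OF xs(4), of j k] that xs(2) by (simp add: p_def)
  have "(\<Prod>k<N. w (p k)) \<le> (4 * ln (1 + \<mu>)) ^ N * (\<Prod>k<N. u (p k))"
  proof (rule prod_le_of_prefix_sums[OF N m])
    fix k assume k: "k < N"
    show "m \<le> w (p k)" "w (p k) \<le> \<mu> * m" using w pN[OF k] by auto
    have "inj_on p {..k}" using p k by (auto simp: bij_betw_def intro: inj_on_subset)
    then have "(\<Sum>j\<le>k. w (p j)) = sum w (p ` {..k})" by (simp add: sum.reindex)
    also have "\<dots> \<le> (\<Sum>i | i < N \<and> u i \<le> u (p k). w i)"
      using mono pN k w(1) m by (intro sum_mono2) (force intro: order_trans)+
    also have "\<dots> \<le> real N * u (p k)" using lower pN k by simp
    finally show "(\<Sum>j\<le>k. w (p j)) \<le> real N * u (p k)" .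
  qed
  then show ?thesis using prod.reindex_bij_betw[OF p, of w] prod.reindex_bij_betw[OF p, of u] by simp
qed

section \<open>The offline optimum and its impartiality ratio\<close>

lemma allocation_nonneg: "x i t \<ge> 0" if "allocation N T s x" "i < N" "t < T"
  using that by (simp add: allocation_def item_allocation_def)

lemma utility_nonneg:
  assumes "valid_instance N T s v" "allocation N T s x" "i < N"
  shows "utility T v x i \<ge> 0"
  unfolding utility_def using assms allocation_nonneg[OF assms(2,3)]
  by (intro sum_nonneg mult_nonneg_nonneg) (auto simp: valid_instance_def)

lemma nash_welfare_nonneg:
  assumes "valid_instance N T s v" "allocation N T s x"
  shows "nash_welfare N T v x \<ge> 0"
  unfolding nash_welfare_def using utility_nonneg[OF assms] 
  by (intro real_root_ge_zero prod_nonneg) auto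

lemma allocation_le_supply: 
  assumes "allocation N T s x" "i < N" "t < T"
  shows "x i t \<le> s t"
proof -
  have "x i t \<le> (\<Sum>i<N. x i t)"
    using assms by (intro member_le_sum) (auto simp: allocation_def item_allocation_def)
  then show ?thesis using assms by (auto simp: allocation_def item_allocation_def)
qed

lemma compact_PiE_UNIV:
  fixes F :: "'i \<Rightarrow> 'a::topological_space set"
  assumes "\<And>i. compact (F i)"
  shows "compact (PiE UNIV F)"
proof -
  have "compactin (product_topology (\<lambda>i. euclidean) UNIV) (PiE UNIV F)"
    using assms by (subst compactin_PiE) auto
  then show ?thesis by (simp add: euclidean_product_topology)
qed

text \<open>A continuous function attains its maximum on a compact set. Compactness comes from
  requiring allocations to vanish outside the agent and item ranges; truncating an allocation in
  this way keeps all utilities.\<close>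

lemma nash_optimal_exists:
  assumes valid: "valid_instance N T s v"
  shows "\<exists>x. nash_optimal N T s v x"
proof -
  define B where "B = PiE UNIV (\<lambda>i. PiE UNIV (\<lambda>t. if i < N \<and> t < T then {0..s t} else {0::real}))"
  define K where "K = B \<inter> {x. \<forall>t. t < T \<longrightarrow> (\<Sum>i<N. x i t) \<le> s t}"
  have coord: "continuous_on S (\<lambda>x :: nat \<Rightarrow> nat \<Rightarrow> real. x i t)" for S i t
    using continuous_on_product_then_coordinatewise[OF continuous_on_product_coordinates]
    by (rule continuous_on_subset) auto
  have "compact B" unfolding B_def by (intro compact_PiE_UNIV) auto
  moreover have "closed {x :: nat \<Rightarrow> nat \<Rightarrow> real. \<forall>t. t < T \<longrightarrow> (\<Sum>i<N. x i t) \<le> s t}"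
    by (intro closed_Collect_all closed_Collect_imp closed_Collect_le continuous_intros coord) auto
  ultimately have "compact K" unfolding K_def by (rule compact_Int_closed)
  moreover have "(\<lambda>_ _. 0) \<in> K"
    using valid by (auto simp: K_def B_def valid_instance_def intro!: less_imp_le)
  moreover have "continuous_on K (\<lambda>x. \<Prod>i<N. utility T v x i)"
    unfolding utility_def by (intro continuous_intros coord)
  ultimately obtain x where x: "x \<in> K"
    and max: "\<And>z. z \<in> K \<Longrightarrow> (\<Prod>i<N. utility T v z i) \<le> (\<Prod>i<N. utility T v x i)"
    using continuous_attains_sup[of K "\<lambda>x. \<Prod>i<N. utility T v x i"] by blast
  have "allocation N T s x"
    unfolding allocation_def item_allocation_def
  proof (intro allI impI conjI)
    fix t i assume t: "t < T"
    show "(\<Sum>i<N. x i t) \<le> s t" using x t by (simp add: K_def)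
    assume "i < N"
    moreover have "x i \<in> PiE UNIV (\<lambda>t. if i < N \<and> t < T then {0..s t} else {0})"
      using x by (auto simp: K_def B_def)
    then have "x i t \<in> (if i < N \<and> t < T then {0..s t} else {0})" by (rule PiE_mem) simp
    ultimately show "0 \<le> x i t" using t by simp
  qed
  moreover have "nash_welfare N T v z \<le> nash_welfare N T v x" if z: "allocation N T s z" for z
  proof -
    define z' where "z' = (\<lambda>i t. if i < N \<and> t < T then z i t else 0)"
    have "z' \<in> K"
      using z allocation_nonneg[OF z] allocation_le_supply[OF z]
      by (auto simp: K_def B_def z'_def allocation_def item_allocation_def)
    moreover have "(\<Prod>i<N. utility T v z' i) = (\<Prod>i<N. utility T v z i)"
      by (intro prod.cong) (auto simp: utility_def z'_def)
    ultimately have "(\<Prod>i<N. utility T v z i) \<le> (\<Prod>i<N. utility T v x i)" using max by metis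
    then show ?thesis using valid by (simp add: nash_welfare_def valid_instance_def)
  qed
  ultimately show ?thesis unfolding nash_optimal_def by blast
qed

lemma opt_nash_welfare_eq:
  assumes "nash_optimal N T s v x"
  shows "opt_nash_welfare N T s v = nash_welfare N T v x"
  unfolding opt_nash_welfare_def using assms
  by (intro cSup_eq_maximum) (auto simp: nash_optimal_def)

lemma nash_optimal_utility_pos:
  assumes valid: "valid_instance N T s v" and x: "nash_optimal N T s v x"
    and opt: "opt_nash_welfare N T s v > 0" and i: "i < N"
  shows "utility T v x i > 0"
proof -
  have "utility T v x i \<noteq> 0"
  proof
    assume "utility T v x i = 0"
    then have "(\<Prod>i<N. utility T v x i) = 0" using i by (intro prod_zero) auto
    then show False using opt unfolding opt_nash_welfare_eq[OF x] nash_welfare_def by (simp only: real_root_zero)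
  qed
  then show ?thesis using utility_nonneg[OF valid _ i] x by (force simp: nash_optimal_def)
qed

text \<open>Varying only item \<open>t\<close> keeps the allocation feasible, so its shares maximize
  a product in which \<open>b\<close> is the utility from the other items. The conclusion is
  \<open>v j t / U j \<le> v i t / U i\<close> cleared of denominators.\<close>

lemma nash_optimal_transfer:
  assumes valid: "valid_instance N T s v" and x: "nash_optimal N T s v x"
    and opt: "opt_nash_welfare N T s v > 0"
    and ijt: "i < N" "j < N" "t < T" "x i t > 0"
  shows "v j t * utility T v x i \<le> v i t * utility T v x j"
proof -
  define b where "b i = (\<Sum>t'\<in>{..<T} - {t}. v i t' * x i t')" for i
  have util: "utility T v (\<lambda>i t'. if t' = t then z i else x i t') i = b i + v i t * z i" for z i
  proof -
    have "(\<Sum>t'\<in>{..<T} - {t}. v i t' * (if t' = t then z i else x i t')) = b i"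
      unfolding b_def by (intro sum.cong) auto
    then show ?thesis using ijt by (simp add: utility_def sum.remove[of _ t])
  qed
  have utilx: "utility T v x i = b i + v i t * x i t" for i
    using ijt by (simp add: utility_def b_def sum.remove[of _ t])
  have "v j t * (b i + v i t * x i t) \<le> v i t * (b j + v j t * x j t)"
  proof (rule max_product_transfer[of N "s t" "\<lambda>i. x i t"])
    show "item_allocation N (s t) (\<lambda>i. x i t)"
      using x ijt by (simp add: nash_optimal_def allocation_def)
    fix z assume z: "item_allocation N (s t) z"
    have "item_allocation N (s t') (\<lambda>i. if t' = t then z i else x i t')" if "t' < T" for t'
      using z x that by (cases "t' = t") (auto simp: nash_optimal_def allocation_def)
    then have "allocation N T s (\<lambda>i t'. if t' = t then z i else x i t')"
      by (simp add: allocation_def)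
    then have "nash_welfare N T v (\<lambda>i t'. if t' = t then z i else x i t') \<le> nash_welfare N T v x"
      using x by (simp add: nash_optimal_def)
    then show "(\<Prod>i<N. b i + v i t * z i) \<le> (\<Prod>i<N. b i + v i t * x i t)"
      using ijt unfolding nash_welfare_def util unfolding utilx by simp
  next
    fix i assume i: "i < N"
    show "b i + v i t * x i t > 0"
      using nash_optimal_utility_pos[OF valid x opt i] by (simp add: utilx)
    show "v i t \<ge> 0" using valid i ijt by (simp add: valid_instance_def)
  qed (use ijt in auto)
  then show ?thesis by (simp add: utilx)
qed

text \<open>All optima share one utility product \<open>P\<close> and each utility is at most
  \<open>V\<close>, hence at least \<open>P / V ^ (N - 1)\<close>. Uniformity over optima makes the
  supremum of the ratios finite.\<close>

lemma nash_optimal_utility_ratio_bounded: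
  assumes valid: "valid_instance N T s v" and opt: "opt_nash_welfare N T s v > 0"
  obtains C where "\<And>x i j. nash_optimal N T s v x \<Longrightarrow> i < N \<Longrightarrow> j < N \<Longrightarrow>
    utility T v x i / utility T v x j \<le> C"
proof -
  define V where "V = 1 + (\<Sum>i<N. \<Sum>t<T. v i t * s t)"
  have v: "v i t \<ge> 0" "s t > 0" if "i < N" "t < T" for i t
    using valid that by (auto simp: valid_instance_def)
  have vs: "(\<Sum>t<T. v i t * s t) \<ge> 0" if "i < N" for i
    using v that by (intro sum_nonneg mult_nonneg_nonneg) (auto intro: less_imp_le)
  have V: "V > 0" unfolding V_def using vs by (intro add_pos_nonneg sum_nonneg[of "{..<N}"]) auto
  define P where "P = opt_nash_welfare N T s v ^ N"
  have P: "P > 0" using opt by (simp add: P_def)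
  have "utility T v x i / utility T v x j \<le> V / (P / V ^ (N - 1))"
    if x: "nash_optimal N T s v x" and ij: "i < N" "j < N" for x i j
  proof -
    have upos: "utility T v x l > 0" if "l < N" for l
      using nash_optimal_utility_pos[OF valid x opt that] .
    have uV: "utility T v x l \<le> V" if l: "l < N" for l
    proof -
      have "utility T v x l \<le> (\<Sum>t<T. v l t * s t)"
        unfolding utility_def using x v l allocation_le_supply[of N T s x l]
        by (intro sum_mono mult_left_mono) (auto simp: nash_optimal_def)
      also have "\<dots> \<le> (\<Sum>i<N. \<Sum>t<T. v i t * s t)"
        using l vs by (intro member_le_sum) auto
      finally show ?thesis by (simp add: V_def)
    qed
    have "P = (\<Prod>l<N. utility T v x l)"
      unfolding P_def opt_nash_welfare_eq[OF x] nash_welfare_def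
      using ij upos by (intro real_root_pow_pos2 prod_nonneg) (auto intro: less_imp_le)
    also have "\<dots> = utility T v x j * (\<Prod>l\<in>{..<N} - {j}. utility T v x l)"
      using ij by (simp add: prod.remove[of _ j])
    also have "\<dots> \<le> utility T v x j * (\<Prod>l\<in>{..<N} - {j}. V)"
      using uV upos ij by (intro mult_left_mono prod_mono) (auto intro: less_imp_le)
    also have "\<dots> = utility T v x j * V ^ (N - 1)" using ij by simp
    finally have "P / V ^ (N - 1) \<le> utility T v x j" using V by (simp add: pos_divide_le_eq)
    then show ?thesis using uV[OF ij(1)] upos[OF ij(1)] V P by (intro frac_le) auto
  qed
  then show thesis by (rule that)
qed

text \<open>The admissible \<open>\<mu>\<close> are the upper bounds of the set \<open>R\<close> of
  utility ratios over all optima, so the \<open>LEAST\<close> is attained and equals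
  \<open>Sup R\<close>. Taking \<open>i = j\<close> puts 1 into \<open>R\<close>.\<close>

lemma impartiality_ratio:
  assumes valid: "valid_instance N T s v" and opt: "opt_nash_welfare N T s v > 0"
  shows "impartial_instance N T s v (impartiality_ratio N T s v)"
    and "impartiality_ratio N T s v \<ge> 1"
proof -
  define R where "R = {utility T v x i / utility T v x j |x i j. nash_optimal N T s v x \<and> i < N \<and> j < N}"
  have pos: "utility T v x j > 0" if "nash_optimal N T s v x" "j < N" for x j
    using nash_optimal_utility_pos[OF valid that(1) opt that(2)] .
  have iff: "impartial_instance N T s v \<mu> \<longleftrightarrow> (\<forall>r\<in>R. r \<le> \<mu>)" for \<mu>
    unfolding impartial_instance_def impartial_allocation_def R_def
    using pos by (fastforce simp: pos_divide_le_eq)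
  obtain C where "\<And>x i j. nash_optimal N T s v x \<Longrightarrow> i < N \<Longrightarrow> j < N \<Longrightarrow>
    utility T v x i / utility T v x j \<le> C"
    using nash_optimal_utility_ratio_bounded[OF valid opt] by blast
  then have bdd: "bdd_above R" by (intro bdd_aboveI[of _ C]) (auto simp: R_def)
  obtain x where x: "nash_optimal N T s v x" using nash_optimal_exists[OF valid] ..
  have "N > 0" using valid by (simp add: valid_instance_def)
  then have "utility T v x 0 / utility T v x 0 \<in> R" using x by (auto simp: R_def)
  then have R1: "1 \<in> R" using pos[OF x \<open>N > 0\<close>] by simp
  have "impartiality_ratio N T s v = Sup R"
    unfolding impartiality_ratio_def iff
    using bdd R1 by (intro Least_equality) (auto intro: cSup_upper cSup_least)
  then show "impartial_instance N T s v (impartiality_ratio N T s v)"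
    "impartiality_ratio N T s v \<ge> 1"
    using bdd R1 by (auto simp: iff intro: cSup_upper)
qed

section \<open>Dyadic sub-items\<close>

lemma sum_lessThan_mult:
  fixes f :: "nat \<Rightarrow> 'a::comm_monoid_add"
  shows "(\<Sum>r<T * L. f r) = (\<Sum>t<T. \<Sum>j<L. f (t * L + j))"
proof (induction T)
  case (Suc T)
  have "(\<Sum>r<a + n. f r) = (\<Sum>r<a. f r) + (\<Sum>j<n. f (a + j))" for a n
    by (induction n) (simp_all add: add.assoc)
  from this[of "T * L" L] show ?case using Suc by (simp add: add.commute)
qed simp

text \<open>Take the least \<open>j\<close> with \<open>V / 2 ^ Suc j \<le> a\<close>: minimality
  gives \<open>a < V / 2 ^ j\<close> when \<open>j > 0\<close>, and \<open>a \<le> V\<close> covers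
  \<open>j = 0\<close>.\<close>

lemma exists_dyadic_level:
  fixes a V :: real
  assumes "L \<ge> 1" "a \<le> V" "V / 2 ^ L \<le> a"
  shows "\<exists>j<L. V / 2 ^ Suc j \<le> a \<and> a \<le> 2 * (V / 2 ^ Suc j)"
proof -
  define j where "j = (LEAST j. V / 2 ^ Suc j \<le> a)"
  have ex: "V / 2 ^ Suc (L - 1) \<le> a" using assms by simp
  have j: "V / 2 ^ Suc j \<le> a" unfolding j_def by (rule LeastI[of _ "L - 1"]) (rule ex)
  have "j \<le> L - 1" unfolding j_def by (rule Least_le) (rule ex)
  moreover have "a \<le> 2 * (V / 2 ^ Suc j)"
  proof (cases j)
    case 0
    then show ?thesis using assms by simp
  next
    case (Suc i)
    then have "\<not> V / 2 ^ Suc i \<le> a" using not_less_Least[of i "\<lambda>j. V / 2 ^ Suc j \<le> a"] by (simp add: j_def)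
    then show ?thesis using Suc by simp
  qed
  ultimately show ?thesis using j assms by (intro exI[of _ j]) auto
qed

lemma max_value_bounds:
  assumes "valid_instance N T s v" "t < T"
  shows "i < N \<Longrightarrow> v i t \<le> max_value N v t" and "max_value N v t \<ge> 0"
    and "\<exists>k<N. v k t = max_value N v t"
proof -
  show le: "v i t \<le> max_value N v t" if "i < N" for i
    using that unfolding max_value_def by (intro Max_ge) auto
  have N: "0 < N" using assms by (simp add: valid_instance_def)
  have "0 \<le> v 0 t" using assms by (simp add: valid_instance_def)
  then show "max_value N v t \<ge> 0" using le[OF N] by linarith
  have "max_value N v t \<in> (\<lambda>i. v i t) ` {..<N}"
    unfolding max_value_def using N by (intro Max_in) auto
  then show "\<exists>k<N. v k t = max_value N v t" by auto
qed

text \<open>Here \<open>j\<close> counts from 0, so \<open>t * L + j\<close> is the sub-item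
  \<open>(t, j + 1)\<close>.\<close>

lemma sub_value_level:
  "j < L \<Longrightarrow> sub_value N L v i (t * L + j) =
    (if max_value N v t / 2 ^ Suc j \<le> v i t then max_value N v t / 2 ^ Suc j else 0)"
  by (simp add: sub_value_def Let_def)

lemma sub_value_level_bounds:
  assumes valid: "valid_instance N T s v" and "i < N" "t < T" "j < L"
  shows "0 \<le> sub_value N L v i (t * L + j)" "sub_value N L v i (t * L + j) \<le> v i t"
  using assms max_value_bounds(2)[OF valid, of t]
  by (auto simp: sub_value_level valid_instance_def)

lemma valid_sub_instance:
  assumes valid: "valid_instance N T s v" and L: "L \<ge> 1"
  shows "valid_instance N (T * L) (sub_supply L s) (sub_value N L v)"
  using valid L max_value_bounds(2)[OF valid]
  by (auto simp: valid_instance_def sub_supply_def sub_value_def Let_def less_mult_imp_div_less)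

text \<open>This is the allocation with which greedy on the sub-items is compared.\<close>

lemma allocation_split_equally:
  assumes x: "allocation N T s x" and L: "L \<ge> 1"
  shows "allocation N (T * L) (sub_supply L s) (\<lambda>i r. x i (r div L) / real L)"
  using x L by (auto simp: allocation_def item_allocation_def sub_supply_def less_mult_imp_div_less
      divide_right_mono simp flip: sum_divide_distrib)

text \<open>One sub-item per item suffices: \<open>high\<close> guarantees a level at most
  \<open>v i t\<close> and at least half of it, and that sub-item carries a \<open>1 / L\<close>
  share of \<open>x i t\<close>.\<close>

lemma utility_split_equally_ge:
  assumes valid: "valid_instance N T s v" and L: "L \<ge> 1" and x: "allocation N T s x" and i: "i < N"
    and high: "\<And>t. t < T \<Longrightarrow> x i t > 0 \<Longrightarrow> max_value N v t / 2 ^ L \<le> v i t"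
  shows "utility T v x i / (2 * real L)
    \<le> utility (T * L) (sub_value N L v) (\<lambda>i r. x i (r div L) / real L) i"
proof -
  have "v i t * x i t / (2 * real L)
    \<le> (\<Sum>j<L. sub_value N L v i (t * L + j) * (x i t / real L))" if t: "t < T" for t
  proof (cases "x i t > 0")
    case True
    obtain j where j: "j < L" "max_value N v t / 2 ^ Suc j \<le> v i t"
      "v i t \<le> 2 * (max_value N v t / 2 ^ Suc j)"
      using exists_dyadic_level[OF L max_value_bounds(1)[OF valid t i] high[OF t True]] by blast
    have "v i t / 2 * (x i t / real L) \<le> sub_value N L v i (t * L + j) * (x i t / real L)"
      using True j by (intro mult_right_mono) (auto simp: sub_value_level)
    also have "\<dots> \<le> (\<Sum>j<L. sub_value N L v i (t * L + j) * (x i t / real L))"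
      using sub_value_level_bounds(1)[OF valid i t] True j
      by (intro member_le_sum[of j "{..<L}" "\<lambda>j. sub_value N L v i (t * L + j) * (x i t / real L)"]
        mult_nonneg_nonneg) auto
    finally show ?thesis by simp
  next
    case False
    moreover have "x i t \<ge> 0" using x i t by (simp add: allocation_def item_allocation_def)
    ultimately show ?thesis by simp
  qed
  then have "(\<Sum>t<T. v i t * x i t / (2 * real L))
    \<le> (\<Sum>t<T. \<Sum>j<L. sub_value N L v i (t * L + j) * (x i t / real L))"
    by (intro sum_mono) auto
  then show ?thesis
    by (simp add: utility_def sum_lessThan_mult sum_divide_distrib)
qed

text \<open>Values are only rounded down, so lower bounds on the rounded utilities of
  \<open>y\<close> carry over to the true utilities of \<open>x\<close>.\<close>

lemma greedy_rounded_sub_outcome: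
  assumes valid: "valid_instance N T s v" and L: "num_levels \<mu> = L" "L \<ge> 1"
    and x: "greedy_rounded N T s v \<mu> x"
  obtains y where "myopic_greedy N (T * L) (sub_supply L s) (sub_value N L v) y"
    and "allocation N T s x"
    and "\<And>i. i < N \<Longrightarrow> 0 \<le> utility (T * L) (sub_value N L v) y i"
    and "\<And>i. i < N \<Longrightarrow> utility (T * L) (sub_value N L v) y i \<le> utility T v x i"
proof -
  obtain y where y: "myopic_greedy N (T * L) (sub_supply L s) (sub_value N L v) y"
    and x1: "\<And>i t. i < N \<Longrightarrow> t < T \<Longrightarrow> x i t = (\<Sum>j=1..L. y i (t * L + (j - 1)))"
    using x L by (auto simp: greedy_rounded_def)
  have "(\<Sum>j=1..L. f (j - 1)) = (\<Sum>j<L. f j)" for f :: "nat \<Rightarrow> real"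
    by (rule sum.reindex_bij_witness[of _ Suc "\<lambda>j. j - 1"]) auto
  then have x: "x i t = (\<Sum>j<L. y i (t * L + j))" if "i < N" "t < T" for i t
    unfolding x1[OF that] .
  have idx: "t * L + j < T * L" if "t < T" "j < L" for t j
  proof -
    have "t * L + j < Suc t * L" using that by simp
    also have "\<dots> \<le> T * L" using that by (intro mult_le_mono1) simp
    finally show ?thesis .
  qed
  have ya: "item_allocation N (s t / real L) (\<lambda>i. y i (t * L + j))" if "t < T" "j < L" for t j
    using y idx[OF that] that by (auto simp: myopic_greedy_def greedy_choice_def sub_supply_def)
  have y0: "y i (t * L + j) \<ge> 0" if "i < N" "t < T" "j < L" for i t j
    using ya that by (simp add: item_allocation_def)
  have "(\<Sum>i<N. x i t) \<le> s t" if t: "t < T" for t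
  proof -
    have "(\<Sum>i<N. x i t) = (\<Sum>i<N. \<Sum>j<L. y i (t * L + j))"
      using x t by (intro sum.cong) auto
    also have "\<dots> = (\<Sum>j<L. \<Sum>i<N. y i (t * L + j))" by (rule sum.swap)
    also have "\<dots> \<le> (\<Sum>j<L. s t / real L)"
      using ya t by (intro sum_mono) (auto simp: item_allocation_def)
    finally show ?thesis using L by simp
  qed
  then have alloc: "allocation N T s x"
    using y0 x by (auto simp: allocation_def item_allocation_def intro!: sum_nonneg)
  have u: "utility (T * L) (sub_value N L v) y i
    = (\<Sum>t<T. \<Sum>j<L. sub_value N L v i (t * L + j) * y i (t * L + j))" for i
    by (simp add: utility_def sum_lessThan_mult)
  have "0 \<le> utility (T * L) (sub_value N L v) y i" if "i < N" for i
    unfolding u using that y0 sub_value_level_bounds(1)[OF valid that]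
    by (intro sum_nonneg mult_nonneg_nonneg) auto
  moreover have "utility (T * L) (sub_value N L v) y i \<le> utility T v x i" if i: "i < N" for i
  proof -
    have "utility (T * L) (sub_value N L v) y i \<le> (\<Sum>t<T. \<Sum>j<L. v i t * y i (t * L + j))"
      unfolding u using i y0 sub_value_level_bounds(2)[OF valid i]
      by (intro sum_mono mult_right_mono) auto
    also have "\<dots> = utility T v x i" using x i by (simp add: utility_def sum_distrib_left)
    finally show ?thesis .
  qed
  ultimately show ?thesis using that y alloc by blast
qed

section \<open>Competitive ratio for a fixed number of levels\<close>

text \<open>The factor is \<open>2 * L\<close> for rounding and splitting, times 4 from the binomial
  bound, times \<open>2 * L\<close> bounding \<open>ln (1 + 2 ^ L)\<close>.\<close>

lemma greedy_rounded_competitive: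
  assumes valid: "valid_instance N T s v" and opt: "opt_nash_welfare N T s v > 0"
    and L: "num_levels \<mu> = L" "L \<ge> 1" "impartiality_ratio N T s v \<le> 2 ^ L"
    and x: "greedy_rounded N T s v \<mu> x"
  shows "opt_nash_welfare N T s v \<le> 16 * (real L)\<^sup>2 * nash_welfare N T v x"
proof -
  have N: "N > 0" using valid by (simp add: valid_instance_def)
  obtain x' where x': "nash_optimal N T s v x'" using nash_optimal_exists[OF valid] ..
  have alloc': "allocation N T s x'" using x' by (simp add: nash_optimal_def)
  have pos: "utility T v x' i > 0" if "i < N" for i
    using nash_optimal_utility_pos[OF valid x' opt that] .
  have imp: "utility T v x' i \<le> 2 ^ L * utility T v x' j" if "i < N" "j < N" for i j
  proof -
    have "utility T v x' i \<le> impartiality_ratio N T s v * utility T v x' j"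
      using impartiality_ratio(1)[OF valid opt] x' that
      by (simp add: impartial_instance_def impartial_allocation_def)
    also have "\<dots> \<le> 2 ^ L * utility T v x' j" using L(3) pos that by (intro mult_right_mono) (auto intro: less_imp_le)
    finally show ?thesis .
  qed
  \<comment> \<open>Compare \<open>i\<close> with an agent \<open>k\<close> of maximum value:
    optimality together with \<open>U k \<le> 2 ^ L * U i\<close> bounds that maximum by
    \<open>2 ^ L * v i t\<close>.\<close>
  have high: "max_value N v t / 2 ^ L \<le> v i t" if it: "i < N" "t < T" "x' i t > 0" for i t
  proof -
    obtain k where k: "k < N" "v k t = max_value N v t" using max_value_bounds(3)[OF valid it(2)] by blast
    have "max_value N v t * utility T v x' i \<le> v i t * utility T v x' k"
      using nash_optimal_transfer[OF valid x' opt it(1) k(1) it(2,3)] k by simp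
    also have "\<dots> \<le> v i t * (2 ^ L * utility T v x' i)"
      using imp[OF k(1) it(1)] valid it by (intro mult_left_mono) (auto simp: valid_instance_def)
    finally have "max_value N v t \<le> v i t * 2 ^ L" using pos[OF it(1)] by (simp add: mult.assoc[symmetric])
    then show ?thesis by (simp add: pos_divide_le_eq)
  qed
  obtain y where y: "myopic_greedy N (T * L) (sub_supply L s) (sub_value N L v) y"
    and x_alloc: "allocation N T s x"
    and y0: "\<And>i. i < N \<Longrightarrow> 0 \<le> utility (T * L) (sub_value N L v) y i"
    and yx: "\<And>i. i < N \<Longrightarrow> utility (T * L) (sub_value N L v) y i \<le> utility T v x i"
    using greedy_rounded_sub_outcome[OF valid L(1,2) x] by blast
  define g where "g = utility (T * L) (sub_value N L v) y"
  \<comment> \<open>\<open>w i\<close> is the rounded utility guaranteed by the equal split;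
    impartiality keeps all \<open>w i\<close> within a factor \<open>2 ^ L\<close> of their minimum
    \<open>m\<close>.\<close>
  define w where "w i = utility T v x' i / (2 * real L)" for i
  define m where "m = Min (w ` {..<N})"
  have mw: "m \<le> w i" if "i < N" for i unfolding m_def using that by (intro Min_le) auto
  have "m \<in> w ` {..<N}" unfolding m_def using N by (intro Min_in) auto
  then obtain i0 where i0: "i0 < N" "m = w i0" by auto
  have w0: "w i > 0" if "i < N" for i using pos[OF that] L by (simp add: w_def)
  have "(\<Prod>i<N. w i) \<le> (4 * ln (1 + 2 ^ L)) ^ N * (\<Prod>i<N. g i)"
  proof (rule prod_le_of_lower_level_sums[OF N])
    show "m > 0" using i0 w0 by simp
    show "m \<le> w i" if "i < N" for i using mw[OF that] .
    show "w i \<le> 2 ^ L * m" if "i < N" for i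
      using imp[OF that i0(1)] L by (simp add: i0(2) w_def divide_right_mono)
    fix k assume k: "k < N"
    have "(\<Sum>i | i < N \<and> g i \<le> g k. w i)
      \<le> (\<Sum>i | i < N \<and> g i \<le> g k. utility (T * L) (sub_value N L v) (\<lambda>i r. x' i (r div L) / real L) i)"
      unfolding w_def using utility_split_equally_ge[OF valid L(2) alloc'] high by (intro sum_mono) auto
    \<comment> \<open>The poverty threshold is the level \<open>g k\<close> itself.\<close>
    also have "\<dots> \<le> real N * g k"
      unfolding g_def
    proof (rule poor_agents_bound[OF valid_sub_instance[OF valid L(2)] _ y allocation_split_equally[OF alloc' L(2)] y0[OF k]])
      show "\<exists>a. \<forall>i<N. sub_value N L v i r = 0 \<or> sub_value N L v i r = a" for r
        by (intro exI[of _ "max_value N v (r div L) / 2 ^ (r mod L + 1)"]) (simp add: sub_value_def Let_def)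
    qed
    finally show "(\<Sum>i | i < N \<and> g i \<le> g k. w i) \<le> real N * g k" .
  qed
  also have "\<dots> \<le> (4 * (2 * real L)) ^ N * (\<Prod>i<N. utility T v x i)"
  proof (intro mult_mono power_mono mult_left_mono)
    have L2: "(2::real) \<le> 2 ^ L" using self_le_power[of "2::real" L] L by simp
    then have "1 + 2 ^ L \<le> 2 * (2::real) ^ L" by linarith
    also have "\<dots> \<le> 2 ^ L * 2 ^ L" using L2 by (intro mult_right_mono) auto
    also have "\<dots> = (2::real) ^ (2 * L)" by (simp add: mult_2 power_add)
    finally have "1 + 2 ^ L \<le> (2::real) ^ (2 * L)" .
    then have "ln (1 + 2 ^ L) \<le> ln ((2::real) ^ (2 * L))" by (intro ln_mono) (auto intro: add_pos_pos)
    also have "\<dots> = 2 * real L * ln 2" by (simp add: ln_realpow)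
    also have "\<dots> \<le> 2 * real L * 1" using ln_2_less_1 by (intro mult_left_mono) auto
    finally show "ln (1 + 2 ^ L) \<le> 2 * real L" by simp
    show "(\<Prod>i<N. g i) \<le> (\<Prod>i<N. utility T v x i)" using y0 yx by (intro prod_mono) (auto simp: g_def)
    show "0 \<le> (\<Prod>i<N. g i)" using y0 by (intro prod_nonneg) (auto simp: g_def)
  qed auto
  \<comment> \<open>Multiplying by \<open>(2 * L) ^ N\<close> restores the optimal utilities from
    \<open>w\<close> before roots are taken.\<close>
  finally have "(2 * real L) ^ N * (\<Prod>i<N. w i)
      \<le> (2 * real L) ^ N * ((4 * (2 * real L)) ^ N * (\<Prod>i<N. utility T v x i))"
    by (intro mult_left_mono) auto
  also have "\<dots> = (2 * real L * (4 * (2 * real L))) ^ N * (\<Prod>i<N. utility T v x i)"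
    by (simp only: power_mult_distrib mult.assoc)
  also have "2 * real L * (4 * (2 * real L)) = 16 * (real L)\<^sup>2" by (simp add: power2_eq_square)
  also have "(2 * real L) ^ N * (\<Prod>i<N. w i) = (\<Prod>i<N. utility T v x' i)"
    using L by (simp add: w_def prod_dividef)
  finally have "root N (\<Prod>i<N. utility T v x' i)
      \<le> root N ((16 * (real L)\<^sup>2) ^ N * (\<Prod>i<N. utility T v x i))"
    using N by simp
  then show ?thesis
    using N by (simp add: opt_nash_welfare_eq[OF x'] nash_welfare_def real_root_mult real_root_power_cancel)
qed

section \<open>Guessing the number of levels\<close>

text \<open>Rounding \<open>log 2 l\<close> up to \<open>k\<close> gives
  \<open>l \<le> 2 ^ k \<le> 2 * l\<close>. The maximum with 2 ensures \<open>l \<ge> 1\<close>, so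
  \<open>log 2 l\<close> is non-negative for small \<open>r\<close> as well.\<close>

lemma exists_doubly_exponential_bound:
  fixes r :: real
  assumes "l = log 2 (max r 2)"
  shows "\<exists>k. r \<le> 2 ^ (2 ^ k) \<and> real (2 ^ k) \<le> 2 * l \<and> real k \<le> 1 + log 2 l"
proof -
  have l: "l \<ge> 1" using assms by simp
  define k where "k = nat \<lceil>log 2 l\<rceil>"
  have l0: "log 2 l \<ge> 0" using l by simp
  have k: "log 2 l \<le> real k" "real k \<le> 1 + log 2 l" using l0 unfolding k_def by linarith+
  have "l = 2 powr (log 2 l)" using l by simp
  also have "\<dots> \<le> 2 powr real k" using k by (intro powr_mono) auto
  finally have lk: "l \<le> 2 ^ k" by (simp add: powr_realpow)
  have "r \<le> 2 powr l" unfolding assms by simp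
  also have "\<dots> \<le> 2 powr real (2 ^ k)" using lk by (intro powr_mono) auto
  finally have "r \<le> 2 ^ (2 ^ k)" by (subst (asm) powr_realpow) auto
  moreover have "2 powr real k \<le> 2 powr (1 + log 2 l)" using k by (intro powr_mono) auto
  then have "real (2 ^ k) \<le> 2 * l" using l by (simp add: powr_realpow powr_add)
  ultimately show ?thesis using k by blast
qed

text \<open>Only the outcome \<open>k\<close> is kept. The bound \<open>C\<close> secures
  integrability; the Bochner integral of a non-integrable function is 0 by default.\<close>

lemma pmf_mult_le_expectation:
  fixes p :: "nat pmf"
  assumes "\<And>k. 0 \<le> f k" "\<And>k. f k \<le> C"
  shows "pmf p k * f k \<le> measure_pmf.expectation p f"
proof -
  have int: "integrable (measure_pmf p) f" "integrable (measure_pmf p) (\<lambda>j. indicator {k} j * f k)"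
  proof -
    show "integrable (measure_pmf p) f"
      using assms by (intro measure_pmf.integrable_const_bound[of _ C]) auto
    show "integrable (measure_pmf p) (\<lambda>j. indicator {k} j * f k)"
      using assms by (intro measure_pmf.integrable_const_bound[of _ "f k"]) (auto simp: indicator_def)
  qed
  have "pmf p k * f k = measure_pmf.expectation p (\<lambda>j. indicator {k} j * f k)"
    using int(2) by (subst integral_mult_left_zero) (simp add: measure_pmf_single)
  also have "\<dots> \<le> measure_pmf.expectation p f"
    using assms int by (intro integral_mono) (auto simp: indicator_def)
  finally show ?thesis .
qed

text \<open>One \<open>\<Gamma>\<close> serves all instances. Each \<open>X k\<close> is an
  arbitrary outcome for the guess \<open>k\<close>, so ties may be broken in any way.\<close>

theorem theorem6:
  shows "\<exists>\<Gamma> :: real \<Rightarrow> real.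
    mono \<Gamma> \<and>
    \<Gamma> \<in> O(\<lambda>\<mu>. (log 2 \<mu>)\<^sup>2 * (log 2 (log 2 \<mu>))\<^sup>2) \<and>
    (\<forall>(N::nat) (T::nat) (s :: nat \<Rightarrow> real) (v :: nat \<Rightarrow> nat \<Rightarrow> real)
      (X :: nat \<Rightarrow> nat \<Rightarrow> nat \<Rightarrow> real).
      valid_instance N T s v \<longrightarrow>
      (\<forall>k. greedy_rounded N T s v (2 ^ (2 ^ k)) (X k)) \<longrightarrow>
      opt_nash_welfare N T s v \<le>
        \<Gamma> (impartiality_ratio N T s v) *
          measure_pmf.expectation guess_pmf (\<lambda>k. nash_welfare N T v (X k)))"
proof -
  define l :: "real \<Rightarrow> real" where "l r = log 2 (max r 2)" for r
  \<comment> \<open>64 comes from \<open>16 * L^2\<close> with \<open>L = 2 ^ k \<le> 2 * l\<close>;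
    the rest bounds the inverse guess probability \<open>pi^2 / 6 * (k + 1)^2\<close> through
    \<open>k + 1 \<le> 2 + log 2 l\<close>.\<close>
  define \<Gamma> :: "real \<Rightarrow> real" where "\<Gamma> r = 64 * (pi\<^sup>2 / 6) * ((l r)\<^sup>2 * (2 + log 2 (l r))\<^sup>2)" for r
  have l1: "l r \<ge> 1" for r by (simp add: l_def)
  have "mono \<Gamma>"
  proof (rule monoI)
    fix r q :: real assume "r \<le> q"
    then have "l r \<le> l q" by (simp add: l_def)
    moreover from this have "log 2 (l r) \<le> log 2 (l q)" using l1[of r] by simp
    moreover have "log 2 (l r) \<ge> 0" using l1[of r] by simp
    ultimately show "\<Gamma> r \<le> \<Gamma> q" unfolding \<Gamma>_def using l1[of r]
      by (intro mult_left_mono mult_mono power_mono) auto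
  qed
  moreover have "\<Gamma> \<in> O(\<lambda>\<mu>. (log 2 \<mu>)\<^sup>2 * (log 2 (log 2 \<mu>))\<^sup>2)"
  proof (rule bigoI)
    show "\<forall>\<^sub>F r in at_top. norm (\<Gamma> r)
      \<le> (64 * (pi\<^sup>2 / 6) * 4) * norm ((log 2 r)\<^sup>2 * (log 2 (log 2 r))\<^sup>2)"
    \<comment> \<open>From 16 on, \<open>log 2 (log 2 r)\<close> is at least 2 and absorbs the
      additive 2 at the cost of a factor 4 after squaring.\<close>
    proof (intro eventually_mono[OF eventually_ge_at_top[of 16]])
      fix r :: real assume r: "16 \<le> r"
      have l: "l r = log 2 r" using r by (simp add: l_def)
      have "log 2 ((2::real) powr 4) \<le> log 2 r" using r by (subst log_le_cancel_iff) auto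
      then have "log 2 r \<ge> 2 powr 2" by (subst (asm) log_powr_cancel) auto
      then have "log 2 (2 powr 2) \<le> log 2 (log 2 r)" by (subst log_le_cancel_iff) auto
      then have ll: "log 2 (log 2 r) \<ge> 2" by (subst (asm) log_powr_cancel) auto
      have "(2 + log 2 (log 2 r))\<^sup>2 \<le> (2 * log 2 (log 2 r))\<^sup>2" using ll by (intro power_mono) auto
      then have "(log 2 r)\<^sup>2 * (2 + log 2 (log 2 r))\<^sup>2 \<le> (log 2 r)\<^sup>2 * (4 * (log 2 (log 2 r))\<^sup>2)"
        by (intro mult_left_mono) (auto simp: power_mult_distrib)
      then have "64 * (pi\<^sup>2 / 6) * ((log 2 r)\<^sup>2 * (2 + log 2 (log 2 r))\<^sup>2)
          \<le> 64 * (pi\<^sup>2 / 6) * ((log 2 r)\<^sup>2 * (4 * (log 2 (log 2 r))\<^sup>2))"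
        by (rule mult_left_mono) simp
      then show "norm (\<Gamma> r) \<le> (64 * (pi\<^sup>2 / 6) * 4) * norm ((log 2 r)\<^sup>2 * (log 2 (log 2 r))\<^sup>2)"
        by (simp add: \<Gamma>_def l abs_mult mult_ac)
    qed
  qed
  moreover have "opt_nash_welfare N T s v \<le> \<Gamma> (impartiality_ratio N T s v) *
      measure_pmf.expectation guess_pmf (\<lambda>k. nash_welfare N T v (X k))"
    if valid: "valid_instance N T s v"
      and X: "\<And>k. greedy_rounded N T s v (2 ^ (2 ^ k)) (X k)" for N T s v X
  proof -
    have L: "num_levels (2 ^ (2 ^ k)) = 2 ^ k" for k
      by (simp add: num_levels_def log_nat_power nat_power_eq)
    have alloc: "allocation N T s (X k)" for k
      using greedy_rounded_sub_outcome[OF valid L _ X[of k]] by auto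
    have nonneg: "0 \<le> nash_welfare N T v (X k)" for k
      using nash_welfare_nonneg[OF valid alloc] .
    obtain x where x: "nash_optimal N T s v x" using nash_optimal_exists[OF valid] ..
    let ?\<mu> = "impartiality_ratio N T s v"
    let ?E = "measure_pmf.expectation guess_pmf (\<lambda>k. nash_welfare N T v (X k))"
    \<comment> \<open>The optimal welfare is the uniform bound that makes the expectation dominate
      each single guess.\<close>
    have E: "pmf guess_pmf k * nash_welfare N T v (X k) \<le> ?E" for k
      using nonneg x alloc by (intro pmf_mult_le_expectation) (auto simp: nash_optimal_def)
    show ?thesis
    proof (cases "opt_nash_welfare N T s v > 0")
      \<comment> \<open>Here the ratio may be unspecified, but \<open>\<Gamma>\<close> is
        non-negative everywhere.\<close>
      case False
      have "?E \<ge> 0" using nonneg by (intro integral_nonneg_AE) auto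
      then have "\<Gamma> ?\<mu> * ?E \<ge> 0" by (simp add: \<Gamma>_def)
      then show ?thesis using False by simp
    next
      case True
      obtain k where k: "?\<mu> \<le> 2 ^ (2 ^ k)" "real (2 ^ k) \<le> 2 * l ?\<mu>" "real k \<le> 1 + log 2 (l ?\<mu>)"
        using exists_doubly_exponential_bound[OF l_def] by blast
      let ?W = "nash_welfare N T v (X k)"
      have W: "?W \<le> pi\<^sup>2 / 6 * (real k + 1)\<^sup>2 * ?E"
        using E[of k] by (simp add: pmf_guess_pmf field_simps)
      have E0: "?E \<ge> 0" using nonneg by (intro integral_nonneg_AE) auto
      have "opt_nash_welfare N T s v \<le> 16 * (real (2 ^ k))\<^sup>2 * ?W"
        using greedy_rounded_competitive[OF valid True L _ k(1) X] by simp
      also have "\<dots> \<le> 16 * (2 * l ?\<mu>)\<^sup>2 * (pi\<^sup>2 / 6 * (2 + log 2 (l ?\<mu>))\<^sup>2 * ?E)"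
      proof (rule mult_mono)
        have "pi\<^sup>2 / 6 * (real k + 1)\<^sup>2 * ?E \<le> pi\<^sup>2 / 6 * (2 + log 2 (l ?\<mu>))\<^sup>2 * ?E"
          using k(3) E0 by (intro mult_right_mono mult_left_mono power_mono) auto
        then show "?W \<le> pi\<^sup>2 / 6 * (2 + log 2 (l ?\<mu>))\<^sup>2 * ?E" using W by linarith
        show "16 * (real (2 ^ k))\<^sup>2 \<le> 16 * (2 * l ?\<mu>)\<^sup>2"
          using power_mono[OF k(2), of 2] by simp
      qed (use nonneg in auto)
      also have "\<dots> = \<Gamma> ?\<mu> * ?E" by (simp add: \<Gamma>_def power_mult_distrib)
      finally show ?thesis .
    qed
  qed
  ultimately show ?thesis by blast
qed

end
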